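(* There is a universal constant $C>0$ such that the following holds. Let $0<\rho\le2$, $L_0>0$, $L_1\ge0$, and let $f:\mathbb{R}^d\to\mathbb{R}\cup\{\infty\}$ be $(\rho,L_0,L_1)$-smooth and convex, attaining its minimum at $x_*\in\mathbb{R}^d$. Let $x_0\in\mathcal{X}$, $R:=\|x_0-x_*\|$, $\Delta:=f(x_0)-f(x_* )$, $\ell(s)=L_0+L_1s^\rho$, and let $\{x_k\}_{k\ge0}$ be generated by $$x_{k+1}=x_k-\gamma_k\nabla f(x_k),\qquad \gamma_k=\int_0^1\frac{dv}{\ell(\|\nabla f(x_k)\|+\|\nabla f(x_k)\|v)}.$$ Then for every $\varepsilon>0$ and every integer $T\ge1$ with $$T\ge C\max\left\{\frac{L_0R^2}{\varepsilon},\ \min\left\{\frac{L_1\Delta^{\rho/2}R^{2-\rho}}{\varepsilon^{1-\rho/2}},\frac{L_1\|\nabla f(x_0)\|^\rho R^2}{\varepsilon}\right\}\right\}$$ one has $f(x_T)-f(x_* )\le\varepsilon$.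
   Context: Norms are Euclidean for vectors and spectral for matrices. For $f:\mathbb{R}^d\to\mathbb{R}\cup\{\infty\}$ put $\mathcal{X}=\{x\in\mathbb{R}^d: f(x)<\infty\}$, assumed to be open and convex. $f$ is $(\rho,L_0,L_1)$-smooth if $f$ is twice differentiable on $\mathcal{X}$, continuous on the closure of $\mathcal{X}$ (as a map into $\mathbb{R}\cup\{\infty\}$), and $\|\nabla^2f(x)\|\le L_0+L_1\|\nabla f(x)\|^\rho$ for all $x\in\mathcal{X}$. (The iteration is well defined: the iterates stay in $\mathcal{X}$.) "Universal" means that $C$ does not depend on $d,f,\rho,L_0,L_1,x_0,x_*,\varepsilon$. *)

theory Defs
  imports "HOL-Analysis.Analysis"
begin

section \<open>The Euclidean spaces R^d inside one type\<close>

text \<open>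
  The constant of the theorem must not depend on the dimension, so the dimension is quantified
  inside the statement and cannot be a type. We use the inner product space of finitely supported
  real sequences, in which R^d is the subspace \<open>Eucl d\<close> of the sequences vanishing from index d on.
  The library's inner product, norm, topology, convexity and Frechet derivatives (within \<open>Eucl d\<close>)
  restrict to the usual Euclidean ones; see \<open>norm_Eucl\<close> and \<open>Eucl_coords\<close>.
\<close>

typedef rvec = "{x :: nat \<Rightarrow> real. finite {i. x i \<noteq> 0}}"
  morphisms coord Abs_rvec
  by (rule exI[of _ "\<lambda>_. 0"]) simp

lemma finite_coord [simp]: "finite {i. coord x i \<noteq> 0}"
  using coord[of x] by simp

lemma coord_Abs: "finite {i. f i \<noteq> 0} \<Longrightarrow> coord (Abs_rvec f) i = f i"
  by (simp add: Abs_rvec_inverse)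

lemma rvec_eq_iff: "x = y \<longleftrightarrow> (\<forall>i. coord x i = coord y i)"
  by (metis coord_inject ext)

instantiation rvec :: real_vector
begin

definition "0 = Abs_rvec (\<lambda>_. 0)"
definition "x + y = Abs_rvec (\<lambda>i. coord x i + coord y i)"
definition "x - y = Abs_rvec (\<lambda>i. coord x i - coord y i)"
definition "- x = Abs_rvec (\<lambda>i. - coord x i)"
definition "a *\<^sub>R x = Abs_rvec (\<lambda>i. a * coord x i)"

lemma coord_zero [simp]: "coord 0 i = 0"
  by (simp add: zero_rvec_def coord_Abs)

lemma coord_add [simp]: "coord (x + y) i = coord x i + coord y i"
  unfolding plus_rvec_def
  by (rule coord_Abs, rule finite_subset[of _ "{i. coord x i \<noteq> 0} \<union> {i. coord y i \<noteq> 0}"]) auto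

lemma coord_diff [simp]: "coord (x - y) i = coord x i - coord y i"
  unfolding minus_rvec_def
  by (rule coord_Abs, rule finite_subset[of _ "{i. coord x i \<noteq> 0} \<union> {i. coord y i \<noteq> 0}"]) auto

lemma coord_minus [simp]: "coord (- x) i = - coord x i"
  by (simp add: uminus_rvec_def coord_Abs)

lemma coord_scaleR [simp]: "coord (a *\<^sub>R x) i = a * coord x i"
  unfolding scaleR_rvec_def
  by (rule coord_Abs, rule finite_subset[of _ "{i. coord x i \<noteq> 0}"]) auto

instance
  by standard (auto simp: rvec_eq_iff algebra_simps)

end

instantiation rvec :: real_inner
begin

definition "inner x y = (\<Sum>i | coord x i \<noteq> 0. coord x i * coord y i)"
definition "norm (x :: rvec) = sqrt (inner x x)"
definition "dist (x :: rvec) y = norm (x - y)"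
definition "sgn (x :: rvec) = x /\<^sub>R norm x"
definition "uniformity = (INF e\<in>{0<..}. principal {(x :: rvec, y). dist x y < e})"
definition "open (U :: rvec set) \<longleftrightarrow> (\<forall>x\<in>U. \<forall>\<^sub>F (x', y) in uniformity. x' = x \<longrightarrow> y \<in> U)"

lemma inner_rvec_superset:
  assumes "finite A" "{i. coord x i \<noteq> 0} \<subseteq> A"
  shows "inner x y = (\<Sum>i\<in>A. coord x i * coord y i)"
  unfolding inner_rvec_def using assms by (intro sum.mono_neutral_left) auto

instance
proof
  fix x y z :: rvec and r :: real
  let ?A = "{i. coord x i \<noteq> 0} \<union> {i. coord y i \<noteq> 0}"
  have A: "finite ?A" by simp
  have "inner x y = (\<Sum>i\<in>?A. coord x i * coord y i)"
    by (rule inner_rvec_superset) auto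
  moreover have "inner y x = (\<Sum>i\<in>?A. coord y i * coord x i)"
    by (rule inner_rvec_superset) auto
  ultimately show "inner x y = inner y x" by (simp add: mult.commute)
  have "inner (x + y) z = (\<Sum>i\<in>?A. coord (x + y) i * coord z i)"
    by (rule inner_rvec_superset) auto
  moreover have "inner x z = (\<Sum>i\<in>?A. coord x i * coord z i)"
    by (rule inner_rvec_superset) auto
  moreover have "inner y z = (\<Sum>i\<in>?A. coord y i * coord z i)"
    by (rule inner_rvec_superset) auto
  ultimately show "inner (x + y) z = inner x z + inner y z"
    by (simp add: sum.distrib algebra_simps)
  have "inner (r *\<^sub>R x) y = (\<Sum>i | coord x i \<noteq> 0. coord (r *\<^sub>R x) i * coord y i)"
    by (rule inner_rvec_superset) auto
  then show "inner (r *\<^sub>R x) y = r * inner x y"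
    by (simp add: inner_rvec_def sum_distrib_left mult.assoc)
  show "0 \<le> inner x x"
    unfolding inner_rvec_def by (rule sum_nonneg) auto
  show "inner x x = 0 \<longleftrightarrow> x = 0"
    unfolding inner_rvec_def
    by (subst sum_nonneg_eq_0_iff) (auto simp: rvec_eq_iff)
qed (simp_all add: norm_rvec_def dist_rvec_def sgn_rvec_def uniformity_rvec_def open_rvec_def)

end

definition Eucl :: "nat \<Rightarrow> rvec set"
  where "Eucl d = {x. \<forall>i\<ge>d. coord x i = 0}"

lemma subspace_Eucl: "subspace (Eucl d)"
  by (auto simp: subspace_def Eucl_def)

lemma inner_Eucl: "x \<in> Eucl d \<Longrightarrow> inner x y = (\<Sum>i<d. coord x i * coord y i)"
  by (rule inner_rvec_superset) (auto simp: Eucl_def not_le[symmetric])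

lemma norm_Eucl: "x \<in> Eucl d \<Longrightarrow> norm x = sqrt (\<Sum>i<d. (coord x i)\<^sup>2)"
  by (simp add: norm_rvec_def inner_Eucl power2_eq_square)

lemma Eucl_coords: "\<exists>!x. x \<in> Eucl d \<and> (\<forall>i<d. coord x i = c i)"
proof
  have "finite {i. (if i < d then c i else 0) \<noteq> (0::real)}"
    by (rule finite_subset[of _ "{..<d}"]) auto
  then show "Abs_rvec (\<lambda>i. if i < d then c i else 0) \<in> Eucl d \<and>
      (\<forall>i<d. coord (Abs_rvec (\<lambda>i. if i < d then c i else 0)) i = c i)"
    by (simp add: Eucl_def coord_Abs)
next
  fix x assume x: "x \<in> Eucl d \<and> (\<forall>i<d. coord x i = c i)"
  have "finite {i. (if i < d then c i else 0) \<noteq> (0::real)}"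
    by (rule finite_subset[of _ "{..<d}"]) auto
  then show "x = Abs_rvec (\<lambda>i. if i < d then c i else 0)"
    using x by (auto simp: rvec_eq_iff coord_Abs Eucl_def not_less)
qed

section \<open>Gradient, Hessian and generalized smoothness\<close>

definition effdom :: "nat \<Rightarrow> (rvec \<Rightarrow> ereal) \<Rightarrow> rvec set"
  where "effdom d f = {x \<in> Eucl d. f x < \<infinity>}"

text \<open>
  Derivatives are only taken at points of \<open>effdom d f\<close>. It is assumed to be open in \<open>Eucl d\<close>, so
  \<open>f\<close> is finite near such a point and \<open>real_of_ereal\<close> loses nothing.
\<close>

definition has_grad :: "nat \<Rightarrow> (rvec \<Rightarrow> ereal) \<Rightarrow> rvec \<Rightarrow> rvec \<Rightarrow> bool"
  where "has_grad d f x g \<longleftrightarrow> g \<in> Eucl d \<and>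
    ((\<lambda>y. real_of_ereal (f y)) has_derivative (\<lambda>h. inner g h)) (at x within Eucl d)"

definition grad :: "nat \<Rightarrow> (rvec \<Rightarrow> ereal) \<Rightarrow> rvec \<Rightarrow> rvec"
  where "grad d f x = (THE g. has_grad d f x g)"

lemma has_grad_unique:
  assumes "x \<in> Eucl d" "has_grad d f x g" "has_grad d f x g'"
  shows "g = g'"
proof -
  have *: "((\<lambda>t. real_of_ereal (f (x + t *\<^sub>R h))) has_derivative (\<lambda>t. inner k (t *\<^sub>R h))) (at 0)"
    if "has_grad d f x k" "h \<in> Eucl d" for h k
  proof -
    have "((\<lambda>y. real_of_ereal (f y)) has_derivative (\<lambda>h. inner k h)) (at (x + 0 *\<^sub>R h) within Eucl d)"
      using that by (simp add: has_grad_def)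
    then have "((\<lambda>y. real_of_ereal (f y)) has_derivative (\<lambda>h. inner k h))
        (at (x + 0 *\<^sub>R h) within (\<lambda>t. x + t *\<^sub>R h) ` UNIV)"
      by (rule has_derivative_subset)
        (use assms(1) that(2) subspace_Eucl in \<open>auto intro: subspace_add subspace_scale\<close>)
    moreover have "((\<lambda>t. x + t *\<^sub>R h) has_derivative (\<lambda>t. t *\<^sub>R h)) (at (0::real))"
      by (auto intro!: derivative_eq_intros)
    ultimately show ?thesis
      using has_derivative_in_compose[of "\<lambda>t. x + t *\<^sub>R h" _ 0 UNIV] by blast
  qed
  let ?h = "g - g'"
  have h: "?h \<in> Eucl d"
    using assms subspace_Eucl by (auto simp: has_grad_def intro: subspace_diff)
  have "(\<lambda>t. inner g (t *\<^sub>R ?h)) = (\<lambda>t. inner g' (t *\<^sub>R ?h))"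
    using *[OF assms(2) h] *[OF assms(3) h] by (rule has_derivative_unique)
  from fun_cong[OF this, of 1] have "inner ?h ?h = 0"
    by (simp add: inner_diff_left)
  then show ?thesis by simp
qed

lemma has_grad_exists:
  assumes x: "x \<in> Eucl d" and "(\<lambda>y. real_of_ereal (f y)) differentiable (at x within Eucl d)"
  shows "\<exists>g. has_grad d f x g"
proof -
  obtain D where D: "((\<lambda>y. real_of_ereal (f y)) has_derivative D) (at x within Eucl d)"
    using assms by (auto simp: differentiable_def)
  then interpret D: bounded_linear D by (rule has_derivative_bounded_linear)
  define e where "e i = Abs_rvec (\<lambda>j. if j = i then 1 else 0)" for i
  have e: "coord (e i) j = (if j = i then 1 else 0)" for i j
    by (simp add: e_def coord_Abs)
  obtain g where g: "g \<in> Eucl d" "\<And>i. i < d \<Longrightarrow> coord g i = D (e i)"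
    using Eucl_coords[of d "\<lambda>i. D (e i)"] by blast
  have coord_sum: "coord (\<Sum>i\<in>A. F i) j = (\<Sum>i\<in>A. coord (F i) j)" for A :: "nat set" and F j
    by (induction A rule: infinite_finite_induct) auto
  have Dg: "D h = inner g h" if "h \<in> Eucl d" for h
  proof -
    have "h = (\<Sum>i<d. coord h i *\<^sub>R e i)"
      using that by (auto simp: rvec_eq_iff coord_sum e Eucl_def if_distrib sum.delta cong: if_cong)
    then have "D h = D (\<Sum>i<d. coord h i *\<^sub>R e i)"
      by (rule arg_cong)
    also have "\<dots> = (\<Sum>i<d. coord h i * D (e i))"
      by (simp add: D.sum D.scaleR)
    finally show ?thesis using g by (simp add: inner_Eucl mult.commute)
  qed
  have ev: "\<forall>\<^sub>F y in at x within Eucl d. D (y - x) = inner g (y - x)"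
    using Dg x subspace_Eucl by (auto simp: eventually_at_filter intro!: always_eventually subspace_diff)
  have "((\<lambda>y. (1 / norm (y - x)) *\<^sub>R (real_of_ereal (f y) - (real_of_ereal (f x) + D (y - x)))) \<longlongrightarrow> 0)
      (at x within Eucl d)"
    using D by (simp add: has_derivative_within)
  then have "((\<lambda>y. (1 / norm (y - x)) *\<^sub>R (real_of_ereal (f y) - (real_of_ereal (f x) + inner g (y - x)))) \<longlongrightarrow> 0)
      (at x within Eucl d)"
    by (rule Lim_transform_eventually) (use ev in \<open>eventually_elim, simp\<close>)
  then have "((\<lambda>y. real_of_ereal (f y)) has_derivative (\<lambda>h. inner g h)) (at x within Eucl d)"
    by (simp add: has_derivative_within bounded_linear_inner_right)
  with g show ?thesis by (auto simp: has_grad_def)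
qed

lemma has_grad_grad:
  assumes "x \<in> Eucl d" "(\<lambda>y. real_of_ereal (f y)) differentiable (at x within Eucl d)"
  shows "has_grad d f x (grad d f x)"
  unfolding grad_def
  using has_grad_exists[OF assms] has_grad_unique[OF assms(1)] by (metis theI)

definition twice_differentiable_on_dom :: "nat \<Rightarrow> (rvec \<Rightarrow> ereal) \<Rightarrow> bool"
  where "twice_differentiable_on_dom d f \<longleftrightarrow>
    (\<forall>x\<in>effdom d f. (\<lambda>y. real_of_ereal (f y)) differentiable (at x within Eucl d)) \<and>
    (\<forall>x\<in>effdom d f. grad d f differentiable (at x within Eucl d))"

text \<open>
  The Hessian is the derivative of the gradient, as a linear map; only its values on \<open>Eucl d\<close>
  are meaningful, and the spectral norm is the operator norm over \<open>Eucl d\<close>.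
\<close>

definition hess :: "nat \<Rightarrow> (rvec \<Rightarrow> ereal) \<Rightarrow> rvec \<Rightarrow> rvec \<Rightarrow> rvec"
  where "hess d f x = frechet_derivative (grad d f) (at x within Eucl d)"

definition spectral_norm :: "nat \<Rightarrow> (rvec \<Rightarrow> rvec) \<Rightarrow> real"
  where "spectral_norm d H = (SUP v\<in>{v \<in> Eucl d. norm v \<le> 1}. norm (H v))"

lemma norm_le_spectral_norm:
  assumes "bounded_linear H" "v \<in> Eucl d"
  shows "norm (H v) \<le> spectral_norm d H * norm v"
proof (cases "v = 0")
  case False
  interpret bounded_linear H by fact
  obtain K where K: "\<And>u. norm (H u) \<le> norm u * K" "0 \<le> K"
    using nonneg_bounded by blast
  have bdd: "bdd_above ((\<lambda>v. norm (H v)) ` {v \<in> Eucl d. norm v \<le> 1})"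
  proof (rule bdd_aboveI2)
    fix u assume "u \<in> {v \<in> Eucl d. norm v \<le> 1}"
    then show "norm (H u) \<le> K"
      using K(1)[of u] K(2) mult_right_mono[of "norm u" 1 K] by simp
  qed
  have "norm (H (v /\<^sub>R norm v)) \<le> spectral_norm d H"
    unfolding spectral_norm_def
    by (rule cSUP_upper[OF _ bdd])
      (use False assms(2) subspace_Eucl in \<open>auto intro: subspace_scale\<close>)
  with False show ?thesis by (simp add: scaleR field_simps)
qed (use assms in \<open>simp add: linear_simps\<close>)

text \<open>
  The growth function \<open>ell\<close>; \<open>powr\<close> gives \<open>ell \<rho> L\<^sub>0 L\<^sub>1 0 = L\<^sub>0\<close>, as it should for \<open>\<rho> > 0\<close>.
\<close>

definition ell :: "real \<Rightarrow> real \<Rightarrow> real \<Rightarrow> real \<Rightarrow> real"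
  where "ell \<rho> L\<^sub>0 L\<^sub>1 s = L\<^sub>0 + L\<^sub>1 * s powr \<rho>"

definition gen_smooth :: "nat \<Rightarrow> real \<Rightarrow> real \<Rightarrow> real \<Rightarrow> (rvec \<Rightarrow> ereal) \<Rightarrow> bool"
  where "gen_smooth d \<rho> L\<^sub>0 L\<^sub>1 f \<longleftrightarrow>
    twice_differentiable_on_dom d f \<and>
    continuous_on (closure (effdom d f)) f \<and>
    (\<forall>x\<in>effdom d f. spectral_norm d (hess d f x) \<le> ell \<rho> L\<^sub>0 L\<^sub>1 (norm (grad d f x)))"

text \<open>
  Convexity of an extended-real-valued function that never takes the value \<open>-\<infinity>\<close>
  (with \<open>0 * \<infinity> = 0\<close> in \<open>ereal\<close>).
\<close>

definition ereal_convex_on :: "rvec set \<Rightarrow> (rvec \<Rightarrow> ereal) \<Rightarrow> bool"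
  where "ereal_convex_on S f \<longleftrightarrow>
    (\<forall>x\<in>S. \<forall>y\<in>S. \<forall>u\<ge>0. \<forall>v\<ge>0. u + v = 1 \<longrightarrow>
      f (u *\<^sub>R x + v *\<^sub>R y) \<le> ereal u * f x + ereal v * f y)"

definition stepsize :: "nat \<Rightarrow> real \<Rightarrow> real \<Rightarrow> real \<Rightarrow> (rvec \<Rightarrow> ereal) \<Rightarrow> rvec \<Rightarrow> real"
  where "stepsize d \<rho> L\<^sub>0 L\<^sub>1 f x =
    integral {0..1} (\<lambda>v. 1 / ell \<rho> L\<^sub>0 L\<^sub>1 (norm (grad d f x) + norm (grad d f x) * v))"

end

theory Submission
  imports Defs
begin

text \<open>
  Write \<open>G\<^sub>k\<close> for the norm of the gradient at \<open>x\<^sub>k\<close>, \<open>\<gamma>\<^sub>k\<close> for the step size and \<open>\<delta>\<^sub>k\<close> for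
  \<open>f(x\<^sub>k) - f(x\<^sub>*)\<close>. The analysis of a single step rests on three properties of the growth function:
  it is continuous and positive, it is nondecreasing, and \<open>l (c * s) \<le> c\<^sup>2 * l s\<close> for \<open>c \<ge> 1\<close>, a
  consequence of \<open>\<rho> \<le> 2\<close>.

  The step size is calibrated so that the gradient varies by at most \<open>t * G\<^sub>k\<close> after a fraction \<open>t\<close>
  of a step (\<open>growth_along_step\<close>): the norm of the variation solves a differential inequality, and
  separating its variables produces exactly the integral that defines \<open>\<gamma>\<^sub>k\<close>. Integrating once more
  gives \<open>f(x\<^sub>k\<^sub>+\<^sub>1) \<le> f(x\<^sub>k) - \<gamma>\<^sub>k * G\<^sub>k\<^sup>2 / 2\<close> (\<open>descent\<close>). The decrease along the segment also keeps it
  inside the effective domain, because \<open>f\<close> is continuous up to the boundary and infinite there.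

  Together with convexity, descent turns the expansion of \<open>\<parallel>x\<^sub>k\<^sub>+\<^sub>1 - x\<^sub>*\<parallel>\<^sup>2\<close> into a decrease by at
  least \<open>2 * \<gamma>\<^sub>k * \<delta>\<^sub>k\<^sub>+\<^sub>1\<close>. Telescoping both inequalities bounds \<open>2 * \<delta>\<^sub>T * \<Sum>\<gamma>\<^sub>k\<close> by \<open>R\<^sup>2\<close> and
  \<open>\<Sum>\<gamma>\<^sub>k * G\<^sub>k\<^sup>2\<close> by \<open>2 * \<Delta>\<close> (\<open>sum_step\<close>, \<open>sum_step_g\<close>).

  If \<open>\<delta>\<^sub>T > \<epsilon>\<close>, then \<open>\<Sum>\<gamma>\<^sub>k \<le> R\<^sup>2 / (2 * \<epsilon>)\<close>. On the other hand \<open>1 / \<gamma>\<^sub>k \<le> l (2 * G\<^sub>k) \<le> 4 * l G\<^sub>k\<close>, so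
  \<open>T = \<Sum>\<gamma>\<^sub>k * (1 / \<gamma>\<^sub>k) \<le> 4 * \<Sum>\<gamma>\<^sub>k * (L\<^sub>0 + L\<^sub>1 * G\<^sub>k\<^sup>\<rho>)\<close>. The part with \<open>L\<^sub>0\<close> is at most twice the
  first term of the maximum. The part with \<open>L\<^sub>1\<close> is bounded in two ways: by interpolating \<open>G\<^sub>k\<^sup>\<rho>\<close> between \<open>G\<^sub>k\<^sup>0\<close> and \<open>G\<^sub>k\<^sup>2\<close>,
  whose weighted sums are both known, and by \<open>G\<^sub>k \<le> G\<^sub>0\<close> (\<open>iteration_count\<close>).

  That the gradient norm never increases (\<open>g_next_le\<close>) is the one delicate point. It follows from
  cocoercivity of the gradient along the step together with \<open>\<gamma>\<^sub>k * l (2 * G\<^sub>k) \<le> 2\<close> (\<open>step_upper\<close>).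
  The usual proof of cocoercivity between two points evaluates \<open>f\<close> at a third point, where the
  Hessian is not controlled; it is therefore carried out in small balls only, passed to the limit as
  the inequality \<open>\<parallel>H u\<parallel>\<^sup>2 \<le> l G * \<langle>H u, u\<rangle>\<close> for the Hessian \<open>H\<close> at a single point, and integrated
  along the segment.
\<close>

section \<open>Growth functions and the step size\<close>

lemma average_antimono:
  fixes w :: "real \<Rightarrow> real"
  assumes cont: "continuous_on {0..1} w"
    and anti: "\<And>u v. 0 \<le> u \<Longrightarrow> u \<le> v \<Longrightarrow> v \<le> 1 \<Longrightarrow> w v \<le> w u"
    and t: "0 \<le> t" "t \<le> 1"
  shows "t * integral {0..1} w \<le> integral {0..t} w"
proof -
  have i1: "w integrable_on {0..1}"
    using cont by (rule integrable_continuous_real)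
  have it: "w integrable_on {0..t}" "w integrable_on {t..1}"
    using t by (auto intro: integrable_subinterval_real[OF i1])
  have split: "integral {0..1} w = integral {0..t} w + integral {t..1} w"
    using Henstock_Kurzweil_Integration.integral_combine[OF t i1] by simp
  have "integral {0..t} (\<lambda>_. w t) \<le> integral {0..t} w"
    using t by (intro integral_le it) (auto intro: anti)
  then have lo: "t * w t \<le> integral {0..t} w"
    using t by simp
  have "integral {t..1} w \<le> integral {t..1} (\<lambda>_. w t)"
    using t by (intro integral_le it) (auto intro: anti)
  then have "integral {t..1} w \<le> (1 - t) * w t"
    using t by simp
  then have "t * integral {t..1} w \<le> (1 - t) * (t * w t)"
    using t mult_left_mono[of "integral {t..1} w" "(1 - t) * w t" t] by (simp add: algebra_simps)
  also have "\<dots> \<le> (1 - t) * integral {0..t} w"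
    using lo t by (intro mult_left_mono) auto
  finally show ?thesis
    by (simp add: split algebra_simps)
qed

locale growth_function =
  fixes l :: "real \<Rightarrow> real"
  assumes l_cont: "continuous_on {0..} l"
    and l_pos: "\<And>s. 0 \<le> s \<Longrightarrow> 0 < l s"
    and l_mono: "\<And>s t. 0 \<le> s \<Longrightarrow> s \<le> t \<Longrightarrow> l s \<le> l t"
    and l_quad: "\<And>c s. 1 \<le> c \<Longrightarrow> 0 \<le> s \<Longrightarrow> l (c * s) \<le> c\<^sup>2 * l s"
begin

text \<open>
  The step size only depends on the norm of the gradient. The integral averages \<open>1 / l\<close> over
  \<open>[G, 2 * G]\<close>, so that \<open>G * step G\<close> is the time in which a solution of \<open>y' = l (G + y)\<close> starting
  at \<open>0\<close> reaches \<open>G\<close>.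
\<close>

definition step :: "real \<Rightarrow> real"
  where "step G = integral {0..1} (\<lambda>v. 1 / l (G + G * v))"

lemma weight_cont:
  assumes "0 \<le> G" "0 \<le> a"
  shows "continuous_on {a..b} (\<lambda>v. 1 / l (G + G * v))"
proof -
  have nn: "0 \<le> G + G * v" if "v \<in> {a..b}" for v
    using assms that by auto
  have "continuous_on {a..b} (\<lambda>v. l (G + G * v))"
    using nn by (intro continuous_on_compose2[OF l_cont]) (auto intro!: continuous_intros)
  moreover have "l (G + G * v) \<noteq> 0" if "v \<in> {a..b}" for v
    using l_pos[OF nn[OF that]] by simp
  ultimately show ?thesis
    by (intro continuous_intros) auto
qed

lemma weight_anti:
  assumes "0 \<le> G" "0 \<le> u" "u \<le> v"
  shows "1 / l (G + G * v) \<le> 1 / l (G + G * u)"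
  using assms by (intro divide_left_mono l_mono mult_pos_pos l_pos) (auto intro: mult_left_mono)

lemma weight_integrable:
  assumes "0 \<le> G" "0 \<le> a"
  shows "(\<lambda>v. 1 / l (G + G * v)) integrable_on {a..b}"
  using weight_cont[OF assms] by (rule integrable_continuous_real)

lemma step_lower:
  assumes "0 \<le> G"
  shows "1 / l (2 * G) \<le> step G"
proof -
  have "integral {0..1::real} (\<lambda>_. 1 / l (2 * G)) \<le> step G"
    unfolding step_def using assms weight_anti[of G _ 1]
    by (intro integral_le weight_integrable) auto
  then show ?thesis by simp
qed

lemma step_pos: "0 \<le> G \<Longrightarrow> 0 < step G"
  using step_lower[of G] l_pos[of "2 * G"] by (smt (verit) divide_pos_pos)

text \<open>
  Quadratic growth gives \<open>1 / l (G + G * v) \<le> (2 / (1 + v))\<^sup>2 / l (2 * G)\<close>, and the integral of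
  \<open>(2 / (1 + v))\<^sup>2\<close> over the unit interval is exactly 2. The constant matters: 2 is the threshold
  below which a gradient step does not increase the norm of the gradient.
\<close>

lemma step_upper:
  assumes "0 \<le> G"
  shows "step G * l (2 * G) \<le> 2"
proof -
  have L: "0 < l (2 * G)" using assms l_pos by simp
  have F: "((\<lambda>v::real. 4 / (1 + v)\<^sup>2) has_integral (- 4 / (1 + 1) - - 4 / (1 + 0))) {0..1}"
    by (rule fundamental_theorem_of_calculus)
      (auto intro!: derivative_eq_intros simp: field_simps power2_eq_square
        simp flip: has_real_derivative_iff_has_vector_derivative)
  have "1 / l (G + G * v) \<le> 4 / (1 + v)\<^sup>2 * (1 / l (2 * G))" if "0 \<le> v" "v \<le> 1" for v
  proof -
    have P: "0 < l (G + G * v)" using assms that l_pos by simp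
    have "(2 / (1 + v)) * (G + G * v) = 2 * G"
      using that by (simp add: divide_simps) (simp add: algebra_simps)
    then have "l (2 * G) = l ((2 / (1 + v)) * (G + G * v))"
      by simp
    also have "\<dots> \<le> (2 / (1 + v))\<^sup>2 * l (G + G * v)"
      using assms that by (intro l_quad) auto
    finally have "l (2 * G) \<le> 4 / (1 + v)\<^sup>2 * l (G + G * v)"
      by (simp add: power_divide)
    moreover have "0 < (1 + v)\<^sup>2" using that by simp
    ultimately show ?thesis
      using L P by (simp add: divide_simps mult.commute)
  qed
  then have "step G \<le> integral {0..1} (\<lambda>v. 4 / (1 + v)\<^sup>2 * (1 / l (2 * G)))"
    unfolding step_def using assms F
    by (intro integral_le weight_integrable integrable_on_mult_left) auto
  also have "\<dots> = 2 * (1 / l (2 * G))"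
    using integral_unique[OF F] by (subst integral_mult_left) simp
  finally show ?thesis using L by (simp add: field_simps)
qed

text \<open>
  Here \<open>p\<close> will be the gradient along a step. Its deviation \<open>n\<close> from \<open>p 0\<close> satisfies
  \<open>n' \<le> step G * G * l (G + n)\<close>. Dividing by \<open>G * l (G + n)\<close>, the integrand \<open>w\<close> of the step size appears,
  and its primitive \<open>P\<close> satisfies \<open>P (n t / G) \<le> step G * t = t * P 1 \<le> P t\<close> because \<open>w\<close> is
  nonincreasing; hence \<open>n t / G \<le> t\<close>.
\<close>

lemma growth_along_step:
  fixes p :: "real \<Rightarrow> 'a::real_inner"
  assumes deriv: "\<And>s. 0 \<le> s \<Longrightarrow> s \<le> t \<Longrightarrow> (p has_vector_derivative p' s) (at s)"
    and bound: "\<And>s. 0 \<le> s \<Longrightarrow> s \<le> t \<Longrightarrow> norm (p' s) \<le> step (norm (p 0)) * norm (p 0) * l (norm (p s))"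
    and t: "0 \<le> t" "t \<le> 1"
  shows "norm (p t - p 0) \<le> t * norm (p 0)"
proof -
  define G where "G = norm (p 0)"
  define w where "w v = 1 / l (G + G * v)" for v
  define P where "P s = integral {0..s} w" for s
  define n where "n s = norm (p s - p 0)" for s
  have G0: "0 \<le> G" by (simp add: G_def)
  have cont_p: "continuous_on {0..t} p"
    using deriv by (auto intro!: continuous_at_imp_continuous_on has_vector_derivative_continuous)
  show ?thesis
  proof (cases "G = 0")
    case True
    have "norm (p t - p 0) \<le> 0 * norm (t - 0)"
    proof (rule differentiable_bound[of "{0..t}" p "\<lambda>s h. h *\<^sub>R p' s"])
      show "(p has_derivative (\<lambda>h. h *\<^sub>R p' s)) (at s within {0..t})" if "s \<in> {0..t}" for s
        using deriv[of s] that
        by (auto simp: has_vector_derivative_def intro: has_derivative_at_withinI)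
      show "onorm (\<lambda>h. h *\<^sub>R p' s) \<le> 0" if "s \<in> {0..t}" for s
      proof -
        have "p' s = 0" using bound[of s] that True by (simp add: G_def)
        then show ?thesis by (simp add: onorm_zero)
      qed
    qed (use t in auto)
    then show ?thesis using True by (simp add: G_def)
  next
    case False
    then have G: "0 < G" using G0 by simp
    have wpos: "0 < w v" if "0 \<le> v" for v
      using l_pos[of "G + G * v"] G that by (simp add: w_def)
    have wanti: "w v \<le> w u" if "0 \<le> u" "u \<le> v" for u v
      using weight_anti[OF G0 that] by (simp add: w_def)
    have wint: "w integrable_on {a..b}" if "0 \<le> a" for a b
      using weight_integrable[OF G0 that] by (simp add: w_def[abs_def])
    have wcont: "continuous_on {a..b} w" if "0 \<le> a" for a b
      using weight_cont[OF G0 that] by (simp add: w_def[abs_def])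
    have Pdiff: "P b - P a = integral {a..b} w" if "0 \<le> a" "a \<le> b" for a b
      using Henstock_Kurzweil_Integration.integral_combine[OF that wint] by (simp add: P_def)
    have Pdiff_ge: "(b - a) * w b \<le> P b - P a" if "0 \<le> a" "a \<le> b" for a b
    proof -
      have "integral {a..b} (\<lambda>_. w b) \<le> integral {a..b} w"
        using that by (intro integral_le wint) (auto intro: wanti)
      then show ?thesis using Pdiff that by simp
    qed
    have Pmono: "P a \<le> P b" if "0 \<le> a" "a \<le> b" for a b
      using Pdiff_ge[OF that] wpos[of b] that by (smt (verit) mult_nonneg_nonneg)
    have P0: "P e \<le> e * w 0" if "0 \<le> e" for e
    proof -
      have "P e \<le> integral {0..e} (\<lambda>_. w 0)"
        unfolding P_def using that by (intro integral_le wint) (auto intro: wanti)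
      then show ?thesis using that by simp
    qed
    \<comment> \<open>The norm is not differentiable at 0, so it is replaced by the smooth majorant \<open>m = sqrt (n\<^sup>2 + e\<^sup>2)\<close>.\<close>
    have key: "P (n t / G) \<le> e / G * w 0 + step G * t" if e: "0 < e" for e
    proof -
      define m where "m s = sqrt (inner (p s - p 0) (p s - p 0) + e\<^sup>2)" for s
      define m' where "m' s = inner (p s - p 0) (p' s) / m s" for s
      have m_pos: "0 < m s" for s
        using e by (auto simp: m_def intro!: add_nonneg_pos)
      have mn: "n s \<le> m s" for s
        unfolding n_def m_def norm_eq_sqrt_inner by (rule real_sqrt_le_mono) simp
      have m0: "m 0 = e" using e by (simp add: m_def)
      have m_deriv: "(m has_real_derivative m' s) (at s)" if "0 \<le> s" "s \<le> t" for s
      proof -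
        have "((\<lambda>s. p s - p 0) has_vector_derivative p' s) (at s)"
          using deriv[OF that] by (auto intro!: derivative_eq_intros)
        then have "((\<lambda>s. p s - p 0) has_derivative (\<lambda>h. h *\<^sub>R p' s)) (at s)"
          by (simp add: has_vector_derivative_def)
        from has_derivative_inner[OF this this]
        have "((\<lambda>s. inner (p s - p 0) (p s - p 0)) has_real_derivative 2 * inner (p s - p 0) (p' s)) (at s)"
          unfolding has_field_derivative_def
          by (rule has_derivative_eq_rhs) (simp add: inner_commute fun_eq_iff)
        then have "((\<lambda>s. inner (p s - p 0) (p s - p 0) + e\<^sup>2) has_real_derivative 2 * inner (p s - p 0) (p' s)) (at s)"
          by (auto intro!: derivative_eq_intros)
        from DERIV_real_sqrt[THEN DERIV_chain2, OF _ this] m_pos[of s]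
        show ?thesis by (simp add: m_def[abs_def] m'_def field_simps)
      qed
      have m'_le: "m' s \<le> step G * G * l (G + m s)" if "0 \<le> s" "s \<le> t" for s
      proof -
        have "inner (p s - p 0) (p' s) \<le> n s * norm (p' s)"
          unfolding n_def by (rule norm_cauchy_schwarz)
        also have "\<dots> \<le> m s * norm (p' s)"
          using mn by (intro mult_right_mono) auto
        finally have "m' s \<le> norm (p' s)"
          using m_pos[of s] by (simp add: m'_def field_simps)
        also have "\<dots> \<le> step G * G * l (norm (p s))"
          using bound[OF that] by (simp add: G_def)
        also have "\<dots> \<le> step G * G * l (G + m s)"
        proof -
          have "norm (p s) \<le> G + n s"
            using norm_triangle_ineq[of "p 0" "p s - p 0"] by (simp add: G_def n_def)
          then have "norm (p s) \<le> G + m s" using mn[of s] by simp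
          then show ?thesis
            using step_pos[OF G0] G0 by (intro mult_left_mono l_mono) auto
        qed
        finally show ?thesis .
      qed
      have m_cont: "continuous_on {0..t} m"
        by (intro continuous_at_imp_continuous_on ballI DERIV_isCont[OF m_deriv]) auto
      \<comment> \<open>\<open>P\<close> is differentiated inside a compact interval that contains the whole range of \<open>m / G\<close>.\<close>
      obtain B where B: "\<And>s. 0 \<le> s \<Longrightarrow> s \<le> t \<Longrightarrow> m s / G < B"
      proof -
        have "bounded (m ` {0..t})"
          by (intro compact_imp_bounded compact_continuous_image m_cont) simp
        then obtain b where b: "\<forall>s\<in>{0..t}. \<bar>m s\<bar> \<le> b"
          unfolding bounded_iff by auto
        show ?thesis
        proof (rule that[of "b / G + 1"])
          fix s assume "0 \<le> s" "s \<le> t"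
          then have "m s \<le> b" using b by (auto dest: bspec[of _ _ s])
          then show "m s / G < b / G + 1" using G by (simp add: field_simps)
        qed
      qed
      define Q where "Q s = P (m s / G) - step G * s" for s
      have Q_deriv: "(Q has_real_derivative w (m s / G) * (m' s / G) - step G) (at s)" if "0 \<le> s" "s \<le> t" for s
      proof -
        have in_B: "0 < m s / G" "m s / G < B"
          using m_pos[of s] G B[OF that] by auto
        have "(P has_real_derivative w (m s / G)) (at (m s / G) within {0..B})"
          unfolding P_def using in_B by (intro integral_has_real_derivative wcont) auto
        then have "(P has_real_derivative w (m s / G)) (at (m s / G))"
          using in_B by (simp add: at_within_Icc_at)
        moreover have "((\<lambda>s. m s / G) has_real_derivative m' s / G) (at s)"
          using m_deriv[OF that] by (rule DERIV_cdivide)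
        ultimately have "((\<lambda>s. P (m s / G)) has_real_derivative w (m s / G) * (m' s / G)) (at s)"
          by (rule DERIV_chain2)
        then show ?thesis
          unfolding Q_def by (auto intro!: derivative_eq_intros)
      qed
      have "Q t \<le> Q 0"
      proof (rule DERIV_nonpos_imp_nonincreasing[OF t(1)])
        fix s assume s: "0 \<le> s" "s \<le> t"
        have "w (m s / G) * (m' s / G) \<le> w (m s / G) * (step G * l (G + m s))"
          using m'_le[OF s] G m_pos[of s] wpos[of "m s / G"]
          by (intro mult_left_mono) (auto simp: field_simps)
        also have "\<dots> = step G"
          using G l_pos[of "G + m s"] m_pos[of s] by (simp add: w_def)
        finally show "\<exists>y. (Q has_real_derivative y) (at s) \<and> y \<le> 0"
          using Q_deriv[OF s] by auto
      qed
      then have "P (m t / G) \<le> P (e / G) + step G * t"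
        by (simp add: Q_def m0)
      moreover have "P (n t / G) \<le> P (m t / G)"
        using mn[of t] G by (intro Pmono) (auto simp: n_def divide_right_mono)
      moreover have "P (e / G) \<le> e / G * w 0"
        using e G by (intro P0) auto
      ultimately show ?thesis by linarith
    qed
    have "P (n t / G) \<le> step G * t"
    proof (rule field_le_epsilon)
      fix e :: real assume "0 < e"
      then have "0 < e * G / w 0" using G wpos[of 0] by simp
      from key[OF this] G wpos[of 0] show "P (n t / G) \<le> step G * t + e"
        by simp
    qed
    also have "\<dots> \<le> P t"
      using average_antimono[OF wcont wanti t] by (simp add: P_def step_def w_def[abs_def] mult.commute)
    finally have le: "P (n t / G) \<le> P t" .
    have "n t / G \<le> t"
    proof (rule ccontr)
      assume "\<not> n t / G \<le> t"
      then have "0 < (n t / G - t) * w (n t / G)"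
        using wpos[of "n t / G"] t by simp
      with Pdiff_ge[of t "n t / G"] t le \<open>\<not> n t / G \<le> t\<close> show False by simp
    qed
    then show ?thesis using G by (simp add: n_def G_def field_simps)
  qed
qed

end

section \<open>Convexity and local cocoercivity of the gradient\<close>

text \<open>
  Derivatives are taken within a subspace \<open>E\<close>, so that one development covers all dimensions. The
  values of \<open>H\<close> are meaningful in directions of \<open>E\<close> only, hence the restricted bound. Closed sublevel sets express that \<open>F\<close> blows up at the boundary of \<open>X\<close>.
\<close>

locale gen_smooth_convex = growth_function l
  for l :: "real \<Rightarrow> real" +
  fixes E X :: "'a::real_inner set" and F :: "'a \<Rightarrow> real" and g :: "'a \<Rightarrow> 'a"
    and H :: "'a \<Rightarrow> 'a \<Rightarrow> 'a"
  assumes E: "subspace E"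
    and X_open: "openin (top_of_set E) X"
    and F_convex: "convex_on X F"
    and F_deriv: "\<And>x. x \<in> X \<Longrightarrow> (F has_derivative inner (g x)) (at x within E)"
    and g_E: "\<And>x. x \<in> X \<Longrightarrow> g x \<in> E"
    and g_deriv: "\<And>x. x \<in> X \<Longrightarrow> (g has_derivative H x) (at x within E)"
    and H_bound: "\<And>x v. x \<in> X \<Longrightarrow> v \<in> E \<Longrightarrow> norm (H x v) \<le> l (norm (g x)) * norm v"
    and sublevel_closed: "\<And>c. closed {x \<in> X. F x \<le> c}"
begin

lemma X_sub: "x \<in> X \<Longrightarrow> x \<in> E"
  using X_open openin_imp_subset by blast

lemma X_convex: "convex X"
  using F_convex by (rule convex_on_imp_convex)

lemma line_E: "x \<in> E \<Longrightarrow> u \<in> E \<Longrightarrow> x + t *\<^sub>R u \<in> E"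
  using E by (simp add: subspace_add subspace_scale)

text \<open>
  A line through a point of \<open>E\<close> in a direction of \<open>E\<close> never leaves \<open>E\<close>. Derivatives within \<open>E\<close>
  therefore become two-sided derivatives of functions of one real variable.
\<close>

lemma has_derivative_line:
  fixes f :: "'a \<Rightarrow> 'b::real_normed_vector"
  assumes f: "(f has_derivative D) (at (x + t *\<^sub>R u) within E)" and "x \<in> E" "u \<in> E"
  shows "((\<lambda>t. f (x + t *\<^sub>R u)) has_vector_derivative D u) (at t)"
proof -
  have "(f has_derivative D) (at (x + t *\<^sub>R u) within (\<lambda>t. x + t *\<^sub>R u) ` UNIV)"
    using f by (rule has_derivative_subset) (use assms(2,3) line_E in auto)
  moreover have "((\<lambda>t. x + t *\<^sub>R u) has_vector_derivative u) (at t)"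
    by (auto intro!: derivative_eq_intros simp: has_vector_derivative_def)
  ultimately show ?thesis
    using vector_derivative_diff_chain_within[of "\<lambda>t. x + t *\<^sub>R u" u t UNIV f D] by (simp add: o_def)
qed

lemma F_line:
  assumes "x \<in> E" "u \<in> E" "x + t *\<^sub>R u \<in> X"
  shows "((\<lambda>t. F (x + t *\<^sub>R u)) has_real_derivative inner (g (x + t *\<^sub>R u)) u) (at t)"
  using has_derivative_line[OF F_deriv[OF assms(3)] assms(1,2)]
  by (simp add: has_real_derivative_iff_has_vector_derivative)

lemma g_line:
  assumes "x \<in> E" "u \<in> E" "x + t *\<^sub>R u \<in> X"
  shows "((\<lambda>t. g (x + t *\<^sub>R u)) has_vector_derivative H (x + t *\<^sub>R u) u) (at t)"
  using has_derivative_line[OF g_deriv[OF assms(3)] assms(1,2)] .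

lemma line_open:
  assumes "x \<in> E" "u \<in> E"
  shows "open {t. x + t *\<^sub>R u \<in> X}"
proof -
  obtain U where U: "open U" "X = E \<inter> U"
    using X_open by (auto simp: openin_open)
  have "{t. x + t *\<^sub>R u \<in> X} = (\<lambda>t. x + t *\<^sub>R u) -` U"
    using assms line_E U by auto
  moreover have "open ((\<lambda>t. x + t *\<^sub>R u) -` U)"
    by (rule open_vimage[OF U(1)]) (intro continuous_intros)
  ultimately show ?thesis by simp
qed

lemma line_comb:
  fixes x u :: 'a
  assumes "a + b = (1::real)"
  shows "x + (a * s + b * t) *\<^sub>R u = a *\<^sub>R (x + s *\<^sub>R u) + b *\<^sub>R (x + t *\<^sub>R u)"
proof -
  have "a *\<^sub>R (x + s *\<^sub>R u) + b *\<^sub>R (x + t *\<^sub>R u) = (a + b) *\<^sub>R x + (a * s + b * t) *\<^sub>R u"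
    by (simp add: algebra_simps)
  then show ?thesis using assms by simp
qed

lemma line_convex: "convex {t. x + t *\<^sub>R u \<in> X}"
  using X_convex by (auto simp: convex_def line_comb)

lemma segment_X:
  assumes "x \<in> X" "x + t *\<^sub>R u \<in> X" "0 \<le> s" "s \<le> t"
  shows "x + s *\<^sub>R u \<in> X"
proof -
  have "is_interval {t. x + t *\<^sub>R u \<in> X}"
    using line_convex by (rule is_interval_convex_1[THEN iffD2])
  then show ?thesis
    using assms mem_is_interval_1_I[of "{t. x + t *\<^sub>R u \<in> X}" 0 t s] by simp
qed

lemma above_tangent:
  assumes x: "x \<in> X" and y: "y \<in> X"
  shows "F x + inner (g x) (y - x) \<le> F y"
proof -
  define A where "A = {t. x + t *\<^sub>R (y - x) \<in> X}"
  have xyE: "x \<in> E" "y - x \<in> E"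
    using x y X_sub E by (auto intro: subspace_diff)
  have A: "open A" "convex A"
    unfolding A_def by (rule line_open[OF xyE], rule line_convex)
  have "convex_on A (\<lambda>t. F (x + t *\<^sub>R (y - x)))"
    unfolding convex_on_def
    using A(2) F_convex by (auto simp: line_comb A_def convex_on_def)
  moreover have "((\<lambda>t. F (x + t *\<^sub>R (y - x))) has_real_derivative inner (g x) (y - x)) (at 0 within A)"
    using F_line[OF xyE, of 0] x by (auto intro: has_field_derivative_at_within)
  moreover have "connected A" "0 \<in> interior A" "1 \<in> A"
    using A x y by (auto simp: interior_open convex_connected A_def)
  ultimately have "inner (g x) (y - x) * (1 - 0)
      \<le> F (x + 1 *\<^sub>R (y - x)) - F (x + 0 *\<^sub>R (y - x))"
    using convex_on_imp_above_tangent[of A "\<lambda>t. F (x + t *\<^sub>R (y - x))" 0 1] by blast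
  then show ?thesis by simp
qed

lemma g_monotone:
  assumes "x \<in> X" "y \<in> X"
  shows "0 \<le> inner (g y - g x) (y - x)"
  using above_tangent[OF assms] above_tangent[OF assms(2,1)]
  by (simp add: inner_diff_left inner_diff_right)

lemma g_lipschitz:
  assumes S: "convex S" "S \<subseteq> X" and M: "\<And>x. x \<in> S \<Longrightarrow> l (norm (g x)) \<le> M"
    and x: "x \<in> S" and y: "y \<in> S"
  shows "norm (g y - g x) \<le> M * norm (y - x)"
proof -
  have xyE: "x \<in> E" "y - x \<in> E"
    using x y S X_sub E by (auto intro: subspace_diff)
  have in_S: "x + t *\<^sub>R (y - x) \<in> S" if "0 \<le> t" "t \<le> 1" for t
    using convexD_alt[OF S(1) x y that] by (simp add: algebra_simps)
  have D: "((\<lambda>t. g (x + t *\<^sub>R (y - x))) has_vector_derivative H (x + t *\<^sub>R (y - x)) (y - x)) (at t)"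
    if "0 \<le> t" "t \<le> 1" for t
    using in_S[OF that] S by (intro g_line[OF xyE]) auto
  have "norm (g (x + 1 *\<^sub>R (y - x)) - g (x + 0 *\<^sub>R (y - x)))
      \<le> 1 * (M * norm (y - x)) - 0 * (M * norm (y - x))"
  proof (rule differentiable_bound_general)
    show "continuous_on {0..1} (\<lambda>t. g (x + t *\<^sub>R (y - x)))"
      by (intro continuous_at_imp_continuous_on ballI has_vector_derivative_continuous[OF D]) auto
    show "norm (H (x + t *\<^sub>R (y - x)) (y - x)) \<le> M * norm (y - x)" if "0 < t" "t < 1" for t
    proof -
      have "norm (H (x + t *\<^sub>R (y - x)) (y - x)) \<le> l (norm (g (x + t *\<^sub>R (y - x)))) * norm (y - x)"
        using in_S[of t] that S xyE by (intro H_bound) auto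
      also have "\<dots> \<le> M * norm (y - x)"
        using in_S[of t] that by (intro mult_right_mono M) auto
      finally show ?thesis .
    qed
  qed (use D in \<open>auto intro!: continuous_intros derivative_eq_intros\<close>)
  then show ?thesis by simp
qed

lemma quadratic_upper_bound:
  assumes S: "convex S" "S \<subseteq> X" and M: "\<And>x. x \<in> S \<Longrightarrow> l (norm (g x)) \<le> M"
    and x: "x \<in> S" and y: "y \<in> S"
  shows "F y \<le> F x + inner (g x) (y - x) + M / 2 * (norm (y - x))\<^sup>2"
proof -
  define u where "u = y - x"
  have xyE: "x \<in> E" "u \<in> E"
    using x y S X_sub E by (auto simp: u_def intro: subspace_diff)
  have in_S: "x + t *\<^sub>R u \<in> S" if "0 \<le> t" "t \<le> 1" for t
    using convexD_alt[OF S(1) x y that] by (simp add: u_def algebra_simps)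
  define Q where "Q t = F (x + t *\<^sub>R u) - t * inner (g x) u - M / 2 * (norm u)\<^sup>2 * t\<^sup>2" for t
  have "Q 1 \<le> Q 0"
  proof (rule DERIV_nonpos_imp_nonincreasing[of 0 1 Q])
    fix t :: real assume t: "0 \<le> t" "t \<le> 1"
    have "(Q has_real_derivative inner (g (x + t *\<^sub>R u)) u - inner (g x) u - M * (norm u)\<^sup>2 * t) (at t)"
      unfolding Q_def using in_S[OF t] S
      by (auto intro!: derivative_eq_intros F_line[OF xyE])
    moreover have "inner (g (x + t *\<^sub>R u)) u - inner (g x) u \<le> M * (norm u)\<^sup>2 * t"
    proof -
      have "inner (g (x + t *\<^sub>R u)) u - inner (g x) u \<le> norm (g (x + t *\<^sub>R u) - g x) * norm u"
        using norm_cauchy_schwarz[of "g (x + t *\<^sub>R u) - g x" u] by (simp add: inner_diff_left)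
      also have "\<dots> \<le> (M * norm (x + t *\<^sub>R u - x)) * norm u"
        by (intro mult_right_mono g_lipschitz[OF S M x in_S[OF t]]) auto
      finally show ?thesis using t by (simp add: power2_eq_square mult_ac)
    qed
    ultimately show "\<exists>z. (Q has_real_derivative z) (at t) \<and> z \<le> 0" by auto
  qed simp
  then show ?thesis by (simp add: Q_def u_def)
qed

text \<open>
  The classical argument: minimality of \<open>F - \<langle>g a, _\<rangle>\<close> at \<open>a\<close> is compared with its value after a
  gradient step of length \<open>1 / M\<close> from \<open>b\<close>, once for each order of the two points. The Lipschitz bound
  makes that step shorter than \<open>2 * r\<close>, hence the ball of radius \<open>3 * r\<close>.
\<close>

lemma cocoercive_ball:
  assumes r: "E \<inter> ball z (3 * r) \<subseteq> X"
    and M: "\<And>x. x \<in> E \<inter> ball z (3 * r) \<Longrightarrow> l (norm (g x)) \<le> M" "0 < M"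
    and x: "x \<in> E \<inter> ball z r" and y: "y \<in> E \<inter> ball z r"
  shows "(norm (g y - g x))\<^sup>2 \<le> M * inner (g y - g x) (y - x)"
proof -
  define S where "S = E \<inter> ball z (3 * r)"
  have S: "convex S" "S \<subseteq> X"
    using r E by (auto simp: S_def intro: convex_Int subspace_imp_convex)
  have r0: "0 < r" using x by (auto intro: le_less_trans[OF zero_le_dist])
  have sub: "E \<inter> ball z r \<subseteq> S"
    using r0 by (auto simp: S_def)
  have half: "(norm (g b - g a))\<^sup>2 / (2 * M) \<le> F b - F a - inner (g a) (b - a)"
    if a: "a \<in> E \<inter> ball z r" and b: "b \<in> E \<inter> ball z r" for a b
  proof -
    define D where "D = g b - g a"
    define c where "c = b - (1 / M) *\<^sub>R D"
    define q where "q = (norm D)\<^sup>2 / M"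
    have ab: "a \<in> S" "b \<in> S" using a b sub by auto
    have "norm D \<le> M * norm (b - a)"
      unfolding D_def using ab M(1) by (intro g_lipschitz[OF S]) (auto simp: S_def)
    then have "norm ((1 / M) *\<^sub>R D) \<le> dist b a"
      using M(2) by (simp add: field_simps dist_norm)
    also have "\<dots> < 2 * r"
      using a b dist_triangle[of b a z] by (simp add: dist_commute)
    finally have "dist z c < 3 * r"
      using b dist_triangle[of z c b] by (simp add: c_def dist_norm)
    moreover have "c \<in> E"
      unfolding c_def D_def using ab S b
      by (intro subspace_diff[OF E] subspace_scale[OF E] g_E) auto
    ultimately have c: "c \<in> S" by (simp add: S_def)
    have "F a + inner (g a) (c - a) \<le> F c"
      using ab c S by (intro above_tangent) auto
    also have "F c \<le> F b + inner (g b) (c - b) + M / 2 * (norm (c - b))\<^sup>2"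
      using ab c M(1) by (intro quadratic_upper_bound[OF S]) (auto simp: S_def)
    finally have "F a + inner (g a) (b - a) + inner (g a) (c - b)
        \<le> F b + inner (g b) (c - b) + M / 2 * (norm (c - b))\<^sup>2"
      by (simp add: inner_diff_right)
    moreover have "inner (g b) (c - b) - inner (g a) (c - b) = - q"
    proof -
      have "inner (g b) (c - b) - inner (g a) (c - b) = inner D (c - b)"
        by (simp add: D_def inner_diff_left)
      then show ?thesis by (simp add: c_def q_def power2_norm_eq_inner)
    qed
    moreover have "M / 2 * (norm (c - b))\<^sup>2 = q / 2"
      using M(2) by (simp add: c_def q_def power2_eq_square)
    moreover have "(norm D)\<^sup>2 / (2 * M) = q / 2"
      by (simp add: q_def)
    ultimately show ?thesis
      unfolding D_def[symmetric] by linarith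
  qed
  from half[OF x y] half[OF y x]
  have "(norm (g y - g x))\<^sup>2 / M \<le> inner (g y - g x) (y - x)"
    by (simp add: norm_minus_commute[of "g x" "g y"] inner_diff_left inner_diff_right)
  then show ?thesis using M(2) by (simp add: field_simps)
qed

text \<open>
  For a symmetric positive semidefinite matrix this is \<open>H\<^sup>2 \<le> \<parallel>H\<parallel> H\<close>. Here it is obtained as a limit of
  difference quotients, with \<open>l (norm (g x)) + e\<close> as Lipschitz constant of \<open>g\<close> near \<open>x\<close>; this avoids
  proving that the Hessian is symmetric.
\<close>

lemma hessian_cocoercive:
  assumes x: "x \<in> X" and u: "u \<in> E"
  shows "(norm (H x u))\<^sup>2 \<le> l (norm (g x)) * inner (H x u) u"
proof -
  have xE: "x \<in> E" using x by (rule X_sub)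
  define D where "D t = (1 / t) *\<^sub>R (g (x + t *\<^sub>R u) - g x)" for t
  have lim: "(D \<longlongrightarrow> H x u) (at 0)"
  proof -
    have "((\<lambda>t. g (x + t *\<^sub>R u)) has_vector_derivative H x u) (at 0)"
      using g_line[OF xE u, of 0] x by simp
    then have "((\<lambda>t. norm (g (x + t *\<^sub>R u) - g x - t *\<^sub>R H x u) / norm t) \<longlongrightarrow> 0) (at 0)"
      by (simp add: has_vector_derivative_def has_derivative_at)
    moreover have "\<forall>\<^sub>F t in at 0. norm (g (x + t *\<^sub>R u) - g x - t *\<^sub>R H x u) / norm t = norm (D t - H x u)"
    proof -
      have "norm (g (x + t *\<^sub>R u) - g x - t *\<^sub>R H x u) / norm t = norm (D t - H x u)" if "t \<noteq> 0" for t
      proof -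
        have "D t - H x u = (1 / t) *\<^sub>R (g (x + t *\<^sub>R u) - g x - t *\<^sub>R H x u)"
          using that by (simp add: D_def scaleR_diff_right)
        then show ?thesis by simp
      qed
      then show ?thesis by (simp add: eventually_at_filter)
    qed
    ultimately have "((\<lambda>t. norm (D t - H x u)) \<longlongrightarrow> 0) (at 0)"
      by (rule Lim_transform_eventually)
    then show ?thesis
      by (simp add: tendsto_norm_zero_iff LIM_zero_iff)
  qed
  have main: "(norm (H x u))\<^sup>2 \<le> (l (norm (g x)) + e) * inner (H x u) u" if e: "0 < e" for e
  proof -
    define M where "M = l (norm (g x)) + e"
    have M0: "0 < M" using e l_pos[of "norm (g x)"] by (simp add: M_def)
    have "continuous (at x within E) g"
      using g_deriv[OF x] by (rule has_derivative_continuous)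
    then have "((\<lambda>y. norm (g y)) \<longlongrightarrow> norm (g x)) (at x within E)"
      by (auto simp: continuous_within intro: tendsto_norm)
    then have "((\<lambda>y. l (norm (g y))) \<longlongrightarrow> l (norm (g x))) (at x within E)"
      by (rule continuous_on_tendsto_compose[OF l_cont]) auto
    then have "\<forall>\<^sub>F y in at x within E. l (norm (g y)) < M"
      using e by (intro order_tendstoD(2)[of _ "l (norm (g x))"]) (auto simp: M_def)
    then obtain r1 where r1: "0 < r1"
      "\<And>y. y \<in> E \<Longrightarrow> y \<noteq> x \<Longrightarrow> dist y x < r1 \<Longrightarrow> l (norm (g y)) < M"
      by (auto simp: eventually_at)
    obtain r2 where r2: "0 < r2" "E \<inter> ball x r2 \<subseteq> X"
      using X_open x by (auto simp: openin_contains_ball Int_commute)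
    define r where "r = min r1 r2 / 3"
    have r: "0 < r" "3 * r \<le> r1" "3 * r \<le> r2" using r1 r2 by (auto simp: r_def)
    have ball: "E \<inter> ball x (3 * r) \<subseteq> X"
      using r2(2) r(3) by auto
    have ballM: "l (norm (g y)) \<le> M" if "y \<in> E \<inter> ball x (3 * r)" for y
      using r1(2)[of y] that r(2) e by (cases "y = x") (auto simp: M_def dist_commute less_imp_le)
    have "\<forall>\<^sub>F t in at 0. x + t *\<^sub>R u \<in> ball x r"
    proof -
      have "((\<lambda>t. x + t *\<^sub>R u) \<longlongrightarrow> x + 0 *\<^sub>R u) (at 0)"
        by (intro tendsto_intros)
      then show ?thesis
        using r(1) by (intro topological_tendstoD[of _ "x + 0 *\<^sub>R u"]) auto
    qed
    moreover have "\<forall>\<^sub>F t in at (0::real). t \<noteq> 0"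
      by (simp add: eventually_at_filter)
    ultimately have "\<forall>\<^sub>F t in at 0. (norm (D t))\<^sup>2 \<le> M * inner (D t) u"
    proof eventually_elim
      case (elim t)
      have "(norm (g (x + t *\<^sub>R u) - g x))\<^sup>2 \<le> M * inner (g (x + t *\<^sub>R u) - g x) (x + t *\<^sub>R u - x)"
        using elim(1) r(1) xE line_E[OF xE u]
        by (intro cocoercive_ball[OF ball ballM M0]) auto
      then have "(norm (g (x + t *\<^sub>R u) - g x))\<^sup>2 / t\<^sup>2
          \<le> (M * inner (g (x + t *\<^sub>R u) - g x) (x + t *\<^sub>R u - x)) / t\<^sup>2"
        by (rule divide_right_mono) simp
      moreover have "(norm (D t))\<^sup>2 = (norm (g (x + t *\<^sub>R u) - g x))\<^sup>2 / t\<^sup>2"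
        by (simp add: D_def power_divide)
      moreover have "M * inner (D t) u = (M * inner (g (x + t *\<^sub>R u) - g x) (x + t *\<^sub>R u - x)) / t\<^sup>2"
        using elim(2) by (simp add: D_def power2_eq_square)
      ultimately show ?case by simp
    qed
    then show ?thesis
      unfolding M_def[symmetric]
      by (intro tendsto_le[OF _ tendsto_mult[OF tendsto_const tendsto_inner[OF lim tendsto_const]]
            tendsto_power[OF tendsto_norm[OF lim]]]) auto
  qed
  have "((\<lambda>e. (l (norm (g x)) + e) * inner (H x u) u) \<longlongrightarrow> (l (norm (g x)) + 0) * inner (H x u) u)
      (at_right 0)"
    by (intro tendsto_intros)
  moreover have "\<forall>\<^sub>F e in at_right 0. (norm (H x u))\<^sup>2 \<le> (l (norm (g x)) + e) * inner (H x u) u"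
    using main by (auto simp: eventually_at_filter)
  ultimately have "(norm (H x u))\<^sup>2 \<le> (l (norm (g x)) + 0) * inner (H x u) u"
    by (rule tendsto_lowerbound) simp
  then show ?thesis by simp
qed

end

section \<open>One step of gradient descent\<close>

context gen_smooth_convex
begin

lemma partial_step:
  assumes x: "x \<in> X" and t: "0 \<le> t" "t \<le> 1"
    and seg: "x + t *\<^sub>R (- (step (norm (g x)) *\<^sub>R g x)) \<in> X"
  defines "u \<equiv> - (step (norm (g x)) *\<^sub>R g x)"
  shows partial_step_g: "norm (g (x + t *\<^sub>R u) - g x) \<le> t * norm (g x)"
    and partial_step_F: "F (x + t *\<^sub>R u) \<le> F x - step (norm (g x)) * (norm (g x))\<^sup>2 * (t - t\<^sup>2 / 2)"
proof -
  define \<gamma> where "\<gamma> = step (norm (g x))"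
  have \<gamma>: "0 < \<gamma>" by (simp add: \<gamma>_def step_pos)
  have xE: "x \<in> E" and uE: "u \<in> E"
    using x X_sub g_E E by (auto simp: u_def intro: subspace_neg subspace_scale)
  have nu: "norm u = \<gamma> * norm (g x)"
    using \<gamma> by (simp add: u_def \<gamma>_def)
  have in_X: "x + s *\<^sub>R u \<in> X" if "0 \<le> s" "s \<le> t" for s
    using segment_X[OF x seg that] by (simp add: u_def)
  have grad: "norm (g (x + s *\<^sub>R u) - g x) \<le> s * norm (g x)" if s: "0 \<le> s" "s \<le> t" for s
  proof -
    have "norm (g (x + s *\<^sub>R u) - g (x + 0 *\<^sub>R u)) \<le> s * norm (g (x + 0 *\<^sub>R u))"
    proof (rule growth_along_step[where p' = "\<lambda>r. H (x + r *\<^sub>R u) u"])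
      fix r assume r: "0 \<le> r" "r \<le> s"
      then have rX: "x + r *\<^sub>R u \<in> X" using in_X s by simp
      show "((\<lambda>t. g (x + t *\<^sub>R u)) has_vector_derivative H (x + r *\<^sub>R u) u) (at r)"
        by (rule g_line[OF xE uE rX])
      show "norm (H (x + r *\<^sub>R u) u) \<le> step (norm (g (x + 0 *\<^sub>R u))) * norm (g (x + 0 *\<^sub>R u))
          * l (norm (g (x + r *\<^sub>R u)))"
        using H_bound[OF rX uE] by (simp add: nu \<gamma>_def mult_ac)
    qed (use s t in auto)
    then show ?thesis by simp
  qed
  then show "norm (g (x + t *\<^sub>R u) - g x) \<le> t * norm (g x)" using t by simp
  define Q where "Q s = F (x + s *\<^sub>R u) + \<gamma> * (norm (g x))\<^sup>2 * (s - s\<^sup>2 / 2)" for s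
  have "Q t \<le> Q 0"
  proof (rule DERIV_nonpos_imp_nonincreasing[OF t(1)])
    fix s assume s: "0 \<le> s" "s \<le> t"
    have "(Q has_real_derivative inner (g (x + s *\<^sub>R u)) u + \<gamma> * (norm (g x))\<^sup>2 * (1 - s)) (at s)"
      unfolding Q_def using in_X[OF s]
      by (auto intro!: derivative_eq_intros F_line[OF xE uE])
    moreover have "inner (g (x + s *\<^sub>R u)) u + \<gamma> * (norm (g x))\<^sup>2 * (1 - s) \<le> 0"
    proof -
      have "inner (g (x + s *\<^sub>R u) - g x) u \<le> norm (g (x + s *\<^sub>R u) - g x) * norm u"
        by (rule norm_cauchy_schwarz)
      also have "\<dots> \<le> (s * norm (g x)) * norm u"
        using grad[OF s] by (rule mult_right_mono) simp
      also have "\<dots> = \<gamma> * (norm (g x))\<^sup>2 * s"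
        by (simp add: nu power2_eq_square)
      finally have "inner (g (x + s *\<^sub>R u)) u \<le> inner (g x) u + \<gamma> * (norm (g x))\<^sup>2 * s"
        by (simp add: inner_diff_left)
      moreover have "inner (g x) u = - \<gamma> * (norm (g x))\<^sup>2"
        by (simp add: u_def \<gamma>_def power2_norm_eq_inner)
      ultimately show ?thesis by (simp add: algebra_simps)
    qed
    ultimately show "\<exists>z. (Q has_real_derivative z) (at s) \<and> z \<le> 0" by auto
  qed
  then show "F (x + t *\<^sub>R u) \<le> F x - step (norm (g x)) * (norm (g x))\<^sup>2 * (t - t\<^sup>2 / 2)"
    by (simp add: Q_def \<gamma>_def)
qed

definition next_pt :: "'a \<Rightarrow> 'a"
  where "next_pt x = x - step (norm (g x)) *\<^sub>R g x"

text \<open>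
  The set of times at which the segment is in \<open>X\<close> is open because \<open>X\<close> is, and closed because \<open>F\<close> stays
  below \<open>F x\<close> at these times and its sublevel sets are closed.
\<close>

lemma segment_in_X:
  assumes x: "x \<in> X" and t: "0 \<le> t" "t \<le> 1"
  shows "x + t *\<^sub>R (- (step (norm (g x)) *\<^sub>R g x)) \<in> X"
proof -
  define u where "u = - (step (norm (g x)) *\<^sub>R g x)"
  have xE: "x \<in> E" and uE: "u \<in> E"
    using x X_sub g_E E by (auto simp: u_def intro: subspace_neg subspace_scale)
  define S where "S = {t \<in> {0..1}. x + t *\<^sub>R u \<in> X}"
  have "openin (top_of_set {0..1}) S"
    using line_open[OF xE uE] by (auto simp: S_def openin_open)
  moreover have "closedin (top_of_set {0..1}) S"
  proof -
    have "F (x + t *\<^sub>R u) \<le> F x" if "t \<in> S" for t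
    proof -
      have "0 \<le> step (norm (g x)) * (norm (g x))\<^sup>2 * (t - t\<^sup>2 / 2)"
        using step_pos[of "norm (g x)"] that mult_left_mono[of t 2 t]
        by (intro mult_nonneg_nonneg) (auto simp: S_def power2_eq_square)
      then show ?thesis
        using partial_step_F[OF x, of t] that by (simp add: S_def u_def)
    qed
    then have "S = {0..1} \<inter> (\<lambda>t. x + t *\<^sub>R u) -` {y \<in> X. F y \<le> F x}"
      by (auto simp: S_def)
    moreover have "closed ((\<lambda>t. x + t *\<^sub>R u) -` {y \<in> X. F y \<le> F x})"
      by (rule closed_vimage[OF sublevel_closed]) (intro continuous_intros)
    ultimately show ?thesis
      by (auto simp: closedin_closed)
  qed
  moreover have "0 \<in> S" using x by (simp add: S_def)
  ultimately have "S = {0..1}"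
    using connected_clopen[of "{0..1::real}"] connected_Icc[of "0::real" 1] by blast
  then have "t \<in> S" using t by simp
  then show ?thesis by (simp add: S_def u_def)
qed

lemma next_pt_X: "x \<in> X \<Longrightarrow> next_pt x \<in> X"
  using segment_in_X[of x 1] by (simp add: next_pt_def)

lemma descent:
  assumes "x \<in> X"
  shows "F (next_pt x) \<le> F x - step (norm (g x)) * (norm (g x))\<^sup>2 / 2"
  using partial_step_F[OF assms, of 1] segment_in_X[OF assms, of 1] by (simp add: next_pt_def)

text \<open>
  With \<open>D\<close> the change of the gradient, integrating the pointwise cocoercivity along the step, where the
  Hessian is bounded by \<open>M = l (2 * G)\<close>, yields \<open>\<parallel>D\<parallel>\<^sup>2 \<le> - \<gamma> * M * \<langle>D, g x\<rangle> \<le> - 2 * \<langle>D, g x\<rangle>\<close>. This says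
  that \<open>\<parallel>g x + D\<parallel>\<^sup>2 \<le> \<parallel>g x\<parallel>\<^sup>2\<close>.
\<close>

lemma g_next_le:
  assumes x: "x \<in> X"
  shows "norm (g (next_pt x)) \<le> norm (g x)"
proof -
  define G where "G = norm (g x)"
  define \<gamma> where "\<gamma> = step G"
  define u where "u = - (\<gamma> *\<^sub>R g x)"
  define M where "M = l (2 * G)"
  define p where "p t = g (x + t *\<^sub>R u)" for t
  define p' where "p' t = H (x + t *\<^sub>R u) u" for t
  define D where "D = p 1 - p 0"
  have \<gamma>: "0 < \<gamma>" by (simp add: \<gamma>_def G_def step_pos)
  have M0: "0 < M" by (simp add: M_def G_def l_pos)
  have xE: "x \<in> E" and uE: "u \<in> E"
    using x X_sub g_E E by (auto simp: u_def intro: subspace_neg subspace_scale)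
  have in_X: "x + t *\<^sub>R u \<in> X" if "0 \<le> t" "t \<le> 1" for t
    using segment_in_X[OF x that] by (simp add: u_def \<gamma>_def G_def)
  have deriv: "(p has_vector_derivative p' t) (at t)" if "0 \<le> t" "t \<le> 1" for t
    unfolding p_def p'_def by (rule g_line[OF xE uE in_X[OF that]])
  define a where "a t = inner (p t) u" for t
  have a_deriv: "(a has_real_derivative inner (p' t) u) (at t)" if "0 \<le> t" "t \<le> 1" for t
    using bounded_linear.has_vector_derivative[OF bounded_linear_inner_left deriv[OF that]]
    by (simp add: a_def[abs_def] has_real_derivative_iff_has_vector_derivative)
  have coco: "(norm (p' t))\<^sup>2 \<le> M * inner (p' t) u" if t: "0 \<le> t" "t \<le> 1" for t
  proof -
    have "norm (p t) \<le> G + norm (p t - g x)"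
      using norm_triangle_ineq[of "g x" "p t - g x"] by (simp add: G_def)
    also have "norm (p t - g x) \<le> t * G"
      using partial_step_g[OF x t] in_X[OF t] by (simp add: p_def u_def \<gamma>_def G_def)
    also have "G + t * G \<le> 2 * G"
      using t by (simp add: G_def mult_right_le_one_le mult_left_le_one_le)
    finally have "l (norm (p t)) \<le> M"
      unfolding M_def by (intro l_mono) auto
    moreover have c: "(norm (p' t))\<^sup>2 \<le> l (norm (p t)) * inner (p' t) u"
      unfolding p_def p'_def by (rule hessian_cocoercive[OF in_X[OF t] uE])
    moreover have "0 \<le> inner (p' t) u"
      using order_trans[OF zero_le_power2 c] l_pos[of "norm (p t)"] by (simp add: zero_le_mult_iff)
    ultimately show ?thesis
      by (meson mult_right_mono order_trans)
  qed
  \<comment> \<open>Cauchy-Schwarz for integrals without integrals: by the weighted arithmetic-geometric mean inequality the speed of \<open>p\<close> is at most the derivative of an explicit function, for every weight \<open>k\<close>; the choice \<open>k = norm D / M\<close> then gives \<open>D_sq\<close>.\<close>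
  have D_le: "norm D \<le> (k * M + (a 1 - a 0) / k) / 2" if k: "0 < k" for k
  proof -
    have "norm (p 1 - p 0) \<le> (k * M * 1 + a 1 / k) / 2 - (k * M * 0 + a 0 / k) / 2"
    proof (rule differentiable_bound_general)
      show p_cont: "continuous_on {0..1} p"
        by (intro continuous_at_imp_continuous_on ballI has_vector_derivative_continuous[OF deriv]) auto
      show "continuous_on {0..1} (\<lambda>t. (k * M * t + a t / k) / 2)"
        unfolding a_def using k by (intro continuous_intros p_cont) auto
      show "((\<lambda>t. (k * M * t + a t / k) / 2) has_vector_derivative (k * M + inner (p' t) u / k) / 2) (at t)"
        if "0 < t" "t < 1" for t
        unfolding has_real_derivative_iff_has_vector_derivative[symmetric]
        using that k by (auto intro!: derivative_eq_intros a_deriv)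
      show "norm (p' t) \<le> (k * M + inner (p' t) u / k) / 2" if "0 < t" "t < 1" for t
      proof -
        have "0 \<le> (norm (p' t) - k * M)\<^sup>2" by simp
        then have "2 * norm (p' t) * (k * M) \<le> (norm (p' t))\<^sup>2 + (k * M)\<^sup>2"
          by (simp add: power2_diff algebra_simps)
        also have "\<dots> \<le> M * inner (p' t) u + (k * M)\<^sup>2"
          using coco[of t] that by simp
        finally have "M * (2 * norm (p' t) * k) \<le> M * (inner (p' t) u + k\<^sup>2 * M)"
          by (simp add: algebra_simps power2_eq_square)
        then have "2 * norm (p' t) * k \<le> inner (p' t) u + k\<^sup>2 * M"
          using M0 by simp
        then show ?thesis
          using k by (simp add: field_simps power2_eq_square)
      qed
    qed (use deriv in auto)
    then show ?thesis by (simp add: D_def diff_divide_distrib add_divide_distrib)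
  qed
  have a_eq: "a 1 - a 0 = - \<gamma> * inner D (g x)"
    by (simp add: a_def D_def u_def inner_diff_left algebra_simps)
  have D_sq: "(norm D)\<^sup>2 \<le> M * (a 1 - a 0)"
  proof (cases "norm D = 0")
    case True
    have "0 \<le> a 1 - a 0"
      using g_monotone[OF in_X[of 0] in_X[of 1]] by (simp add: a_def p_def inner_diff_left)
    then show ?thesis using M0 True by simp
  next
    case False
    then have k: "0 < norm D / M" using M0 by simp
    show ?thesis using D_le[OF k] M0 False by (simp add: field_simps power2_eq_square)
  qed
  have nonneg: "0 \<le> - inner D (g x)"
  proof -
    have "0 \<le> a 1 - a 0"
      using order_trans[OF zero_le_power2 D_sq] M0 by (simp add: zero_le_mult_iff)
    then show ?thesis using \<gamma> by (simp add: a_eq mult_le_0_iff)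
  qed
  have "(norm D)\<^sup>2 \<le> (\<gamma> * M) * (- inner D (g x))"
    using D_sq by (simp add: a_eq algebra_simps)
  also have "\<dots> \<le> 2 * (- inner D (g x))"
    using step_upper[of G] nonneg by (intro mult_right_mono) (auto simp: \<gamma>_def M_def G_def)
  finally have "(norm (g x + D))\<^sup>2 \<le> (norm (g x))\<^sup>2"
    by (simp add: power2_norm_eq_inner inner_add_left inner_add_right inner_commute)
  moreover have "g x + D = g (next_pt x)"
    by (simp add: D_def p_def u_def next_pt_def \<gamma>_def G_def)
  ultimately show ?thesis by simp
qed

text \<open>
  The quadratic term of the expansion is \<open>\<gamma>\<^sup>2 * (norm (g x))\<^sup>2\<close>, which \<open>descent\<close> bounds by
  \<open>2 * \<gamma> * (F x - F (next_pt x))\<close>. This replaces the value at \<open>x\<close>, which comes from convexity, by the value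
  at the next point.
\<close>

lemma distance_decrease:
  assumes x: "x \<in> X" and z: "z \<in> X"
  shows "(norm (next_pt x - z))\<^sup>2 \<le> (norm (x - z))\<^sup>2 - 2 * step (norm (g x)) * (F (next_pt x) - F z)"
proof -
  define \<gamma> where "\<gamma> = step (norm (g x))"
  have \<gamma>: "0 < \<gamma>" by (simp add: \<gamma>_def step_pos)
  have "next_pt x - z = (x - z) - \<gamma> *\<^sub>R g x"
    by (simp add: next_pt_def \<gamma>_def)
  moreover have "(norm ((x - z) - \<gamma> *\<^sub>R g x))\<^sup>2
      = (norm (x - z))\<^sup>2 - 2 * \<gamma> * inner (g x) (x - z) + \<gamma>\<^sup>2 * (norm (g x))\<^sup>2"
    unfolding power2_norm_eq_inner inner_diff_left[of "x - z"] inner_diff_right[of _ "x - z"]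
    by (simp add: inner_commute[of "x - z" "g x"] power2_eq_square)
  ultimately have "(norm (next_pt x - z))\<^sup>2
      = (norm (x - z))\<^sup>2 - 2 * \<gamma> * inner (g x) (x - z) + \<gamma>\<^sup>2 * (norm (g x))\<^sup>2"
    by (simp only:)
  moreover have "2 * \<gamma> * (F x - F z) \<le> 2 * \<gamma> * inner (g x) (x - z)"
    using above_tangent[OF x z] \<gamma> by (intro mult_left_mono) (auto simp: inner_diff_right)
  moreover have "2 * \<gamma> * (\<gamma> * (norm (g x))\<^sup>2 / 2) \<le> 2 * \<gamma> * (F x - F (next_pt x))"
    using descent[OF x] \<gamma> by (intro mult_left_mono) (auto simp: \<gamma>_def)
  ultimately show ?thesis
    by (simp add: \<gamma>_def[symmetric] power2_eq_square algebra_simps)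
qed

context
  fixes x :: "nat \<Rightarrow> 'a"
  assumes x0: "x 0 \<in> X" and x_Suc: "\<And>k. x (Suc k) = next_pt (x k)"
begin

lemma iter_X: "x k \<in> X"
  by (induction k) (auto simp: x0 x_Suc next_pt_X)

lemma iter_F_antimono: "k \<le> m \<Longrightarrow> F (x m) \<le> F (x k)"
proof (induction rule: dec_induct)
  case (step m)
  have "0 \<le> local.step (norm (g (x m))) * (norm (g (x m)))\<^sup>2 / 2"
    using step_pos[of "norm (g (x m))"] by simp
  then show ?case using step descent[OF iter_X[of m]] by (simp add: x_Suc)
qed simp

lemma iter_g_le: "norm (g (x k)) \<le> norm (g (x 0))"
  by (induction k) (auto simp: x_Suc intro: order_trans[OF g_next_le[OF iter_X]])

lemma sum_step_g:
  "(\<Sum>k<T. step (norm (g (x k))) * (norm (g (x k)))\<^sup>2) \<le> 2 * (F (x 0) - F (x T))"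
proof (induction T)
  case (Suc T)
  then show ?case using descent[OF iter_X[of T]] by (simp add: x_Suc)
qed simp

text \<open>
  Since the values of \<open>F\<close> decrease, each summand \<open>F (x (Suc k)) - F z\<close> of the telescoped
  \<open>distance_decrease\<close> may be replaced by the last one.
\<close>

lemma sum_step:
  assumes z: "z \<in> X"
  shows "2 * (F (x T) - F z) * (\<Sum>k<T. step (norm (g (x k)))) \<le> (norm (x 0 - z))\<^sup>2"
proof -
  have "2 * (F (x T) - F z) * (\<Sum>k<S. step (norm (g (x k)))) \<le> (norm (x 0 - z))\<^sup>2 - (norm (x S - z))\<^sup>2"
    if "S \<le> T" for S
    using that
  proof (induction S)
    case (Suc S)
    have "2 * step (norm (g (x S))) * (F (x T) - F z) \<le> 2 * step (norm (g (x S))) * (F (x (Suc S)) - F z)"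
      using step_pos[of "norm (g (x S))"] iter_F_antimono[OF Suc.prems] by (intro mult_left_mono) auto
    then show ?case
      using Suc distance_decrease[OF iter_X[of S] z] by (simp add: x_Suc algebra_simps)
  qed simp
  from this[OF order_refl] zero_le_power2[of "norm (x T - z)"] show ?thesis
    by linarith
qed

end

end

section \<open>Counting iterations\<close>

text \<open>
  Needed to see that finite values at the closure of the effective domain are values inside it.
\<close>

lemma closed_Eucl: "closed (Eucl d)"
proof -
  define e where "e i = Abs_rvec (\<lambda>j. if j = i then 1 else 0)" for i
  have e: "coord (e i) j = (if j = i then 1 else 0)" for i j
    by (simp add: e_def coord_Abs)
  have "inner (e i) x = coord x i" for i x
    by (subst inner_rvec_superset[of "{i}"]) (auto simp: e)
  then have "Eucl d = (\<Inter>i\<in>{d..}. {x. inner (e i) x = 0})"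
    by (auto simp: Eucl_def)
  then show ?thesis
    by (auto intro!: closed_INT closed_Collect_eq continuous_intros)
qed

lemma growth_function_ell:
  assumes "0 < \<rho>" "\<rho> \<le> 2" "0 < L\<^sub>0" "0 \<le> L\<^sub>1"
  shows "growth_function (ell \<rho> L\<^sub>0 L\<^sub>1)"
proof
  show "continuous_on {0..} (ell \<rho> L\<^sub>0 L\<^sub>1)"
    unfolding ell_def using assms by (intro continuous_intros continuous_on_powr') auto
  show "0 < ell \<rho> L\<^sub>0 L\<^sub>1 s" for s
    unfolding ell_def using assms by (intro add_pos_nonneg) auto
  show "ell \<rho> L\<^sub>0 L\<^sub>1 s \<le> ell \<rho> L\<^sub>0 L\<^sub>1 t" if "0 \<le> s" "s \<le> t" for s t
    unfolding ell_def using assms that by (auto intro!: mult_left_mono powr_mono2)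
  show "ell \<rho> L\<^sub>0 L\<^sub>1 (c * s) \<le> c\<^sup>2 * ell \<rho> L\<^sub>0 L\<^sub>1 s" if c: "1 \<le> c" and s: "0 \<le> s" for c s
  proof -
    have "c powr \<rho> \<le> c powr 2" using assms(2) c by (rule powr_mono)
    then have "c powr \<rho> \<le> c\<^sup>2" using c by simp
    then have "L\<^sub>1 * (c powr \<rho> * s powr \<rho>) \<le> L\<^sub>1 * (c\<^sup>2 * s powr \<rho>)"
      using assms(4) by (intro mult_left_mono mult_right_mono) auto
    moreover have "L\<^sub>0 \<le> c\<^sup>2 * L\<^sub>0"
      using assms(3) c one_le_power[of c 2] by simp
    ultimately show ?thesis
      using c s by (simp add: ell_def powr_mult algebra_simps)
  qed
qed

text \<open>
  Stands in for Hoelder's inequality: for a scale \<open>m\<close> chosen as the ratio of two known sums, it bounds a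
  weighted sum of powers with exponent in \<open>[0, 1]\<close> up to a factor of 2.
\<close>

lemma powr_le_affine:
  fixes s m a :: real
  assumes "0 \<le> s" "0 < m" "0 \<le> a" "a \<le> 1"
  shows "s powr a \<le> m powr a * (1 + s / m)"
proof -
  have "(s / m) powr a \<le> 1 + s / m"
  proof (cases "s / m \<le> 1")
    case True
    then have "(s / m) powr a \<le> 1" using assms by (intro powr_le1) auto
    then show ?thesis using assms by (simp add: add_increasing2)
  next
    case False
    then have "(s / m) powr a \<le> (s / m) powr 1" using assms by (intro powr_mono) auto
    also have "\<dots> = s / m" using assms by simp
    finally show ?thesis by simp
  qed
  then have "m powr a * (s / m) powr a \<le> m powr a * (1 + s / m)"
    by (rule mult_left_mono) simp
  moreover have "m powr a * (s / m) powr a = s powr a"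
    using assms by (simp flip: powr_mult)
  ultimately show ?thesis by simp
qed

text \<open>
  Each of the \<open>T\<close> iterations contributes at least 1 to \<open>\<Sum>\<gamma>\<^sub>k * 4 * l G\<^sub>k\<close>. In this sum the part with \<open>L\<^sub>0\<close>
  is at most 2 times the first term of the maximum, and the part with \<open>L\<^sub>1\<close> is at most 16 times the
  first and 2 times the second term of the minimum; hence the constant \<open>18 = 2 + 16\<close>.
\<close>

lemma iteration_count:
  fixes \<gamma> G :: "nat \<Rightarrow> real"
  assumes par: "0 < \<rho>" "\<rho> \<le> 2" "0 < L\<^sub>0" "0 \<le> L\<^sub>1" "0 < \<epsilon>" "0 < R" "0 < \<Delta>"
    and \<gamma>: "\<And>k. 0 \<le> \<gamma> k" "\<And>k. 1 \<le> \<gamma> k * (4 * ell \<rho> L\<^sub>0 L\<^sub>1 (G k))"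
    and G: "\<And>k. 0 \<le> G k" "\<And>k. G k \<le> G 0"
    and sum_G: "(\<Sum>k<T. \<gamma> k * (G k)\<^sup>2) \<le> 2 * \<Delta>"
    and sum: "2 * \<epsilon> * (\<Sum>k<T. \<gamma> k) \<le> R\<^sup>2"
  shows "real T \<le> 18 * max (L\<^sub>0 * R\<^sup>2 / \<epsilon>)
      (min (L\<^sub>1 * \<Delta> powr (\<rho> / 2) * R powr (2 - \<rho>) / \<epsilon> powr (1 - \<rho> / 2))
        (L\<^sub>1 * G 0 powr \<rho> * R\<^sup>2 / \<epsilon>))"
proof -
  define S where "S = (\<Sum>k<T. \<gamma> k)"
  define P where "P = (\<Sum>k<T. \<gamma> k * G k powr \<rho>)"
  have S: "S \<le> R\<^sup>2 / (2 * \<epsilon>)"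
    using sum par by (simp add: S_def field_simps)
  have "real T = (\<Sum>k<T. 1)" by simp
  also have "\<dots> \<le> (\<Sum>k<T. \<gamma> k * (4 * ell \<rho> L\<^sub>0 L\<^sub>1 (G k)))"
    by (rule sum_mono) (rule \<gamma>)
  also have "\<dots> = 4 * L\<^sub>0 * S + 4 * L\<^sub>1 * P"
    unfolding S_def P_def sum_distrib_left sum.distrib[symmetric]
    by (intro sum.cong) (auto simp: ell_def algebra_simps)
  finally have T: "real T \<le> 4 * L\<^sub>0 * S + 4 * L\<^sub>1 * P" .
  have L0: "4 * L\<^sub>0 * S \<le> 2 * (L\<^sub>0 * R\<^sup>2 / \<epsilon>)"
    using mult_left_mono[OF S, of "4 * L\<^sub>0"] par by simp
  have "P \<le> (\<Sum>k<T. \<gamma> k * G 0 powr \<rho>)"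
    unfolding P_def using par \<gamma>(1) G by (intro sum_mono mult_left_mono powr_mono2) auto
  also have "\<dots> = G 0 powr \<rho> * S"
    by (simp add: S_def mult.commute flip: sum_distrib_right)
  also have "\<dots> \<le> G 0 powr \<rho> * (R\<^sup>2 / (2 * \<epsilon>))"
    by (intro mult_left_mono S) simp
  finally have B: "4 * L\<^sub>1 * P \<le> 2 * (L\<^sub>1 * G 0 powr \<rho> * R\<^sup>2 / \<epsilon>)"
    using mult_left_mono[of P "G 0 powr \<rho> * (R\<^sup>2 / (2 * \<epsilon>))" "4 * L\<^sub>1"] par by simp
  \<comment> \<open>The quotient of the bounds \<open>2 * \<Delta>\<close> and \<open>R\<^sup>2 / (2 * \<epsilon>)\<close> of the two sums, which balances the two terms of \<open>powr_le_affine\<close>.\<close>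
  define m where "m = 4 * \<Delta> * \<epsilon> / R\<^sup>2"
  have m: "0 < m" using par by (simp add: m_def)
  have G_powr: "G k powr \<rho> \<le> m powr (\<rho> / 2) * (1 + (G k)\<^sup>2 / m)" for k
  proof -
    have "G k powr \<rho> = ((G k)\<^sup>2) powr (\<rho> / 2)"
      using G(1)[of k] by (cases "G k = 0") (auto simp: powr_powr simp flip: powr_numeral)
    then show ?thesis using powr_le_affine[of "(G k)\<^sup>2" m "\<rho> / 2"] m par by simp
  qed
  have "P \<le> (\<Sum>k<T. \<gamma> k * (m powr (\<rho> / 2) * (1 + (G k)\<^sup>2 / m)))"
    unfolding P_def by (intro sum_mono mult_left_mono G_powr \<gamma>)
  also have "\<dots> = m powr (\<rho> / 2) * (S + (\<Sum>k<T. \<gamma> k * (G k)\<^sup>2) / m)"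
    unfolding S_def sum_divide_distrib sum.distrib[symmetric] sum_distrib_left
    by (intro sum.cong) (auto simp: algebra_simps)
  also have "\<dots> \<le> m powr (\<rho> / 2) * (R\<^sup>2 / (2 * \<epsilon>) + 2 * \<Delta> / m)"
    using m by (intro mult_left_mono add_mono S divide_right_mono sum_G) auto
  also have "\<dots> = m powr (\<rho> / 2) * (R\<^sup>2 / \<epsilon>)"
    using par by (simp add: m_def field_simps)
  finally have P1: "P \<le> m powr (\<rho> / 2) * (R\<^sup>2 / \<epsilon>)" .
  have "m powr (\<rho> / 2) * (R\<^sup>2 / \<epsilon>)
      = 4 powr (\<rho> / 2) * (\<Delta> powr (\<rho> / 2) * R powr (2 - \<rho>) / \<epsilon> powr (1 - \<rho> / 2))"
  proof -
    have "(R\<^sup>2) powr (\<rho> / 2) = R powr \<rho>"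
      using par by (simp add: powr_powr flip: powr_numeral)
    then have "m powr (\<rho> / 2) = 4 powr (\<rho> / 2) * \<Delta> powr (\<rho> / 2) * \<epsilon> powr (\<rho> / 2) / R powr \<rho>"
      using par by (simp add: m_def powr_divide powr_mult)
    moreover have "R powr (2 - \<rho>) = R\<^sup>2 / R powr \<rho>"
      using par by (simp add: powr_diff)
    moreover have "\<epsilon> powr (1 - \<rho> / 2) = \<epsilon> / \<epsilon> powr (\<rho> / 2)"
      using par by (simp add: powr_diff)
    ultimately show ?thesis by simp
  qed
  also have "\<dots> \<le> 4 * (\<Delta> powr (\<rho> / 2) * R powr (2 - \<rho>) / \<epsilon> powr (1 - \<rho> / 2))"
    using powr_mono[of "\<rho> / 2" 1 4] par by (intro mult_right_mono) auto
  finally have P2: "m powr (\<rho> / 2) * (R\<^sup>2 / \<epsilon>)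
      \<le> 4 * (\<Delta> powr (\<rho> / 2) * R powr (2 - \<rho>) / \<epsilon> powr (1 - \<rho> / 2))" .
  have A: "4 * L\<^sub>1 * P \<le> 16 * (L\<^sub>1 * \<Delta> powr (\<rho> / 2) * R powr (2 - \<rho>) / \<epsilon> powr (1 - \<rho> / 2))"
    using mult_left_mono[OF order_trans[OF P1 P2], of "4 * L\<^sub>1"] par by (simp add: mult_ac)
  have "0 \<le> L\<^sub>1 * G 0 powr \<rho> * R\<^sup>2 / \<epsilon>" using par by simp
  with T L0 A B show ?thesis
    by (simp add: max_def min_def split: if_splits)
qed

theorem mainTheorem11:
  shows "\<exists>C::real. C > 0 \<and>
    (\<forall>(d::nat) (\<rho>::real) (L\<^sub>0::real) (L\<^sub>1::real) (f :: rvec \<Rightarrow> ereal) (xs::rvec) (x :: nat \<Rightarrow> rvec).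
      0 < \<rho> \<longrightarrow> \<rho> \<le> 2 \<longrightarrow> 0 < L\<^sub>0 \<longrightarrow> 0 \<le> L\<^sub>1 \<longrightarrow>
      (\<forall>y\<in>Eucl d. f y \<noteq> -\<infinity>) \<longrightarrow>
      openin (top_of_set (Eucl d)) (effdom d f) \<longrightarrow>
      convex (effdom d f) \<longrightarrow>
      gen_smooth d \<rho> L\<^sub>0 L\<^sub>1 f \<longrightarrow>
      ereal_convex_on (Eucl d) f \<longrightarrow>
      xs \<in> Eucl d \<longrightarrow> (\<forall>y\<in>Eucl d. f xs \<le> f y) \<longrightarrow>
      x 0 \<in> effdom d f \<longrightarrow>
      (\<forall>k. x (Suc k) = x k - stepsize d \<rho> L\<^sub>0 L\<^sub>1 f (x k) *\<^sub>R grad d f (x k)) \<longrightarrow>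
      (let R = norm (x 0 - xs); \<Delta> = real_of_ereal (f (x 0) - f xs) in
        \<forall>(\<epsilon>::real) (T::nat). 0 < \<epsilon> \<longrightarrow> 1 \<le> T \<longrightarrow>
          real T \<ge> C * max (L\<^sub>0 * R\<^sup>2 / \<epsilon>)
                        (min (L\<^sub>1 * \<Delta> powr (\<rho> / 2) * R powr (2 - \<rho>) / \<epsilon> powr (1 - \<rho> / 2))
                             (L\<^sub>1 * norm (grad d f (x 0)) powr \<rho> * R\<^sup>2 / \<epsilon>)) \<longrightarrow>
          f (x T) - f xs \<le> ereal \<epsilon>))"
  unfolding Let_def
\<comment> \<open>One more than the 18 of \<open>iteration_count\<close>: then \<open>19 * max \<le> T \<le> 18 * max\<close> forces \<open>max \<le> 0\<close>, hence \<open>T \<le> 0\<close>.\<close>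
proof (intro exI[of _ 19] conjI allI impI)
  fix d :: nat and \<rho> L\<^sub>0 L\<^sub>1 :: real and f :: "rvec \<Rightarrow> ereal" and xs :: rvec
    and x :: "nat \<Rightarrow> rvec" and \<epsilon> :: real and T :: nat
  let ?X = "effdom d f" and ?F = "\<lambda>y. real_of_ereal (f y)" and ?l = "ell \<rho> L\<^sub>0 L\<^sub>1"
  let ?R = "norm (x 0 - xs)" and ?\<Delta> = "real_of_ereal (f (x 0) - f xs)"
  assume par: "0 < \<rho>" "\<rho> \<le> 2" "0 < L\<^sub>0" "0 \<le> L\<^sub>1"
    and not_minf: "\<forall>y\<in>Eucl d. f y \<noteq> -\<infinity>"
    and X_open: "openin (top_of_set (Eucl d)) ?X"
    and X_convex: "convex ?X"
    and smooth: "gen_smooth d \<rho> L\<^sub>0 L\<^sub>1 f"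
    and f_convex: "ereal_convex_on (Eucl d) f"
    and xs: "xs \<in> Eucl d" "\<forall>y\<in>Eucl d. f xs \<le> f y"
    and x0: "x 0 \<in> ?X"
    and x_Suc: "\<forall>k. x (Suc k) = x k - stepsize d \<rho> L\<^sub>0 L\<^sub>1 f (x k) *\<^sub>R grad d f (x k)"
    and \<epsilon>: "0 < \<epsilon>" and T1: "1 \<le> T"
    and T: "19 * max (L\<^sub>0 * ?R\<^sup>2 / \<epsilon>)
        (min (L\<^sub>1 * ?\<Delta> powr (\<rho> / 2) * ?R powr (2 - \<rho>) / \<epsilon> powr (1 - \<rho> / 2))
          (L\<^sub>1 * norm (grad d f (x 0)) powr \<rho> * ?R\<^sup>2 / \<epsilon>)) \<le> real T"
  have X_Eucl: "y \<in> Eucl d" if "y \<in> ?X" for y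
    using that by (simp add: effdom_def)
  have f_F: "f y = ereal (?F y)" if "y \<in> ?X" for y
    using that not_minf by (cases "f y") (auto simp: effdom_def)
  interpret gen_smooth_convex ?l "Eucl d" ?X ?F "grad d f" "hess d f"
  proof (intro gen_smooth_convex.intro gen_smooth_convex_axioms.intro growth_function_ell par
      subspace_Eucl X_open)
    show "convex_on ?X ?F"
      unfolding convex_on_def
    proof (intro conjI X_convex ballI allI impI)
      fix y z and u v :: real
      assume yz: "y \<in> ?X" "z \<in> ?X" and uv: "0 \<le> u" "0 \<le> v" "u + v = 1"
      have "f (u *\<^sub>R y + v *\<^sub>R z) \<le> ereal u * f y + ereal v * f z"
        using f_convex yz uv X_Eucl by (auto simp: ereal_convex_on_def)
      moreover have "u *\<^sub>R y + v *\<^sub>R z \<in> ?X"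
        using X_convex yz uv by (auto simp: convex_def)
      ultimately show "?F (u *\<^sub>R y + v *\<^sub>R z) \<le> u * ?F y + v * ?F z"
        using f_F[OF yz(1)] f_F[OF yz(2)] f_F[of "u *\<^sub>R y + v *\<^sub>R z"]
        by (metis ereal_less_eq(3) plus_ereal.simps(1) times_ereal.simps(1))
    qed
    fix y assume y: "y \<in> ?X"
    have hg: "has_grad d f y (grad d f y)"
      using smooth y by (intro has_grad_grad X_Eucl) (auto simp: gen_smooth_def twice_differentiable_on_dom_def)
    then show "(?F has_derivative inner (grad d f y)) (at y within Eucl d)"
      and "grad d f y \<in> Eucl d"
      by (auto simp: has_grad_def)
    show hd: "(grad d f has_derivative hess d f y) (at y within Eucl d)"
      using smooth y unfolding hess_def
      by (auto simp: gen_smooth_def twice_differentiable_on_dom_def frechet_derivative_works[symmetric])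
    show "norm (hess d f y v) \<le> ?l (norm (grad d f y)) * norm v" if "v \<in> Eucl d" for v
    proof -
      have "norm (hess d f y v) \<le> spectral_norm d (hess d f y) * norm v"
        using has_derivative_bounded_linear[OF hd] that by (rule norm_le_spectral_norm)
      also have "\<dots> \<le> ?l (norm (grad d f y)) * norm v"
        using smooth y by (intro mult_right_mono) (auto simp: gen_smooth_def)
      finally show ?thesis .
    qed
  next
    fix c :: real
    have "closure ?X \<subseteq> Eucl d"
      using closed_Eucl X_Eucl by (intro closure_minimal) auto
    moreover have "y \<in> ?X" if "y \<in> Eucl d" "f y \<le> ereal c" for y
      using that by (auto simp: effdom_def intro: le_less_trans)
    moreover have "f y \<le> ereal c \<longleftrightarrow> ?F y \<le> c" if "y \<in> ?X" for y
      using f_F[OF that] by (metis ereal_less_eq(3))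
    ultimately have "{y \<in> ?X. ?F y \<le> c} = closure ?X \<inter> f -` {..ereal c}"
      using closure_subset[of ?X] by blast
    moreover have "closed (closure ?X \<inter> f -` {..ereal c})"
      using smooth by (intro continuous_closed_preimage) (auto simp: gen_smooth_def)
    ultimately show "closed {y \<in> ?X. ?F y \<le> c}" by simp
  qed
  have next_eq: "x (Suc k) = next_pt (x k)" for k
    using x_Suc by (simp add: next_pt_def step_def stepsize_def)
  have xX: "x k \<in> ?X" for k
    by (rule iter_X[of x, OF x0 next_eq])
  have xsX: "xs \<in> ?X"
    using xs x0 by (auto simp: effdom_def intro: le_less_trans)
  have \<Delta>: "?\<Delta> = ?F (x 0) - ?F xs"
    using f_F[OF x0] f_F[OF xsX] by (metis ereal_minus(1) real_of_ereal.simps(1))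
  have "?F (x T) - ?F xs \<le> \<epsilon>"
  proof (rule ccontr)
    assume "\<not> ?F (x T) - ?F xs \<le> \<epsilon>"
    then have big: "\<epsilon> < ?F (x T) - ?F xs" by simp
    let ?\<gamma> = "\<lambda>k. step (norm (grad d f (x k)))" and ?G = "\<lambda>k. norm (grad d f (x k))"
    have \<Delta>_pos: "0 < ?\<Delta>"
      using iter_F_antimono[of x 0 T, OF x0 next_eq] big \<epsilon> by (simp add: \<Delta>)
    have R_pos: "0 < ?R"
      using \<Delta>_pos by (auto simp: \<Delta>)
    have sum: "2 * \<epsilon> * (\<Sum>k<T. ?\<gamma> k) \<le> ?R\<^sup>2"
    proof -
      have "2 * \<epsilon> * (\<Sum>k<T. ?\<gamma> k) \<le> 2 * (?F (x T) - ?F xs) * (\<Sum>k<T. ?\<gamma> k)"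
        using big step_pos by (intro mult_right_mono sum_nonneg) (auto intro: less_imp_le)
      also have "\<dots> \<le> ?R\<^sup>2"
        by (rule sum_step[of x, OF x0 next_eq xsX])
      finally show ?thesis .
    qed
    have "real T \<le> 18 * max (L\<^sub>0 * ?R\<^sup>2 / \<epsilon>)
        (min (L\<^sub>1 * ?\<Delta> powr (\<rho> / 2) * ?R powr (2 - \<rho>) / \<epsilon> powr (1 - \<rho> / 2))
          (L\<^sub>1 * ?G 0 powr \<rho> * ?R\<^sup>2 / \<epsilon>))"
    proof (rule iteration_count[OF par \<epsilon> R_pos \<Delta>_pos, where \<gamma> = ?\<gamma>])
      show "0 \<le> ?\<gamma> k" for k
        using step_pos by (simp add: less_imp_le)
      show "1 \<le> ?\<gamma> k * (4 * ?l (?G k))" for k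
      proof -
        have "1 \<le> ?\<gamma> k * ?l (2 * ?G k)"
          using step_lower[of "?G k"] l_pos[of "2 * ?G k"] by (simp add: field_simps)
        also have "\<dots> \<le> ?\<gamma> k * (4 * ?l (?G k))"
          using l_quad[of 2 "?G k"] step_pos[of "?G k"] by (intro mult_left_mono) auto
        finally show ?thesis .
      qed
      show "?G k \<le> ?G 0" for k
        by (rule iter_g_le[of x, OF x0 next_eq])
      show "(\<Sum>k<T. ?\<gamma> k * (?G k)\<^sup>2) \<le> 2 * ?\<Delta>"
        using sum_step_g[of x T, OF x0 next_eq] iter_F_antimono[of x 0 T, OF x0 next_eq] big \<epsilon>
        by (simp add: \<Delta>)
    qed (use sum in auto)
    with T T1 show False by linarith
  qed
  then show "f (x T) - f xs \<le> ereal \<epsilon>"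
    using f_F[OF xX[of T]] f_F[OF xsX] by (metis ereal_minus(1) ereal_less_eq(3))
qed simp

end
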